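(* Let $\lambda>\aleph_1$ be a regular cardinal. Then: (0) there is a surjective homomorphism $\Phi:\langle\mathcal G_\lambda,\le_w\rangle\to\langle[\mathbb R]^{\le\lambda},\subseteq\rangle$; (1) such a $\Phi$ can be chosen to be a composition $\psi\circ\varphi$, where, for some normal ideal $I$ over $\lambda$, $\varphi$ is a surjective homomorphism from $\langle\mathcal G_\lambda,\le_w\rangle$ onto the reduced power $\left([\mathbb R]^{\le\lambda},\subseteq\right)^\lambda/I$ and $\psi$ is a homomorphism from this reduced power to $\langle[\mathbb R]^{\le\lambda},\subseteq\rangle$.
   Context: A ray is a one-way infinite path; two rays are tail-equivalent iff they share a common tail (an infinite connected subgraph of each). $\mathcal G$ is the class of all graphs $G$ such that for every vertex $v$, the induced subgraph spanned by the neighbourhood $G[v]$ of $v$ has at most one ray up to tail-equivalence. $\mathcal G_\lambda$ is the set of isomorphism types of members of $\mathcal G$ with exactly $\lambda$ vertices. $G_1\le_w G_2$ means $G_1$ is isomorphic to a (not necessarily induced) subgraph of $G_2$; this is a quasi-order. $[\mathbb R]^{\le\lambda}$ is the set of subsets of $\mathbb R$ of cardinality at most $\lambda$. A homomorphism between quasi-orders is an order-preserving map (e.g. $G_1\le_w G_2\Rightarrow\Phi(G_1)\subseteq\Phi(G_2)$). An ideal $I$ on $\lambda$ is normal if it is closed under diagonal unions. The reduced power $\left([\mathbb R]^{\le\lambda},\subseteq\right)^\lambda/I$ consists of the equivalence classes of functions $f:\lambda\to[\mathbb R]^{\le\lambda}$, where $f\sim g$ iff $\{\delta<\lambda:f(\delta)\ne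 g(\delta)\}\in I$, quasi-ordered by $[f]\subseteq_I[g]$ iff $\{\delta<\lambda:f(\delta)\not\subseteq g(\delta)\}\in I$. *)

theory Defs
  imports Complex_Main "HOL-Library.FuncSet"
begin

unbundle cardinal_syntax

record 'v ugraph =
  verts :: "'v set"
  edges :: "'v set set"

definition is_graph :: "'v ugraph \<Rightarrow> bool" where
  "is_graph G \<longleftrightarrow> (\<forall>e \<in> edges G. e \<subseteq> verts G \<and> card e = 2)"

definition subgraph :: "'v ugraph \<Rightarrow> 'v ugraph \<Rightarrow> bool" where
  "subgraph H G \<longleftrightarrow> is_graph H \<and> is_graph G \<and> verts H \<subseteq> verts G \<and> edges H \<subseteq> edges G"

definition induced :: "'v ugraph \<Rightarrow> 'v set \<Rightarrow> 'v ugraph" where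
  "induced G U = \<lparr>verts = verts G \<inter> U, edges = {e \<in> edges G. e \<subseteq> U}\<rparr>"

definition nbhd :: "'v ugraph \<Rightarrow> 'v \<Rightarrow> 'v set" where
  "nbhd G v = {u \<in> verts G. {v, u} \<in> edges G}"

definition connected_graph :: "'v ugraph \<Rightarrow> bool" where
  "connected_graph G \<longleftrightarrow>
     (\<forall>u \<in> verts G. \<forall>v \<in> verts G. (u, v) \<in> {(x, y). {x, y} \<in> edges G}\<^sup>*)"

definition is_ray :: "'v ugraph \<Rightarrow> bool" where
  "is_ray R \<longleftrightarrow> (\<exists>p :: nat \<Rightarrow> 'v. inj p \<and>
     verts R = range p \<and> edges R = range (\<lambda>n. {p n, p (Suc n)}))"

definition tail_equivalent :: "'v ugraph \<Rightarrow> 'v ugraph \<Rightarrow> bool" where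
  "tail_equivalent R S \<longleftrightarrow>
     (\<exists>T. infinite (verts T) \<and> connected_graph T \<and> subgraph T R \<and> subgraph T S)"

definition in_class_G :: "'v ugraph \<Rightarrow> bool" where
  "in_class_G G \<longleftrightarrow> is_graph G \<and>
     (\<forall>v \<in> verts G. \<forall>R S.
        is_ray R \<and> subgraph R (induced G (nbhd G v)) \<and>
        is_ray S \<and> subgraph S (induced G (nbhd G v)) \<longrightarrow> tail_equivalent R S)"

definition graph_iso :: "'v ugraph \<Rightarrow> 'w ugraph \<Rightarrow> bool" where
  "graph_iso G H \<longleftrightarrow> (\<exists>f. bij_betw f (verts G) (verts H) \<and>
     (\<forall>u \<in> verts G. \<forall>v \<in> verts G. {u, v} \<in> edges G \<longleftrightarrow> {f u, f v} \<in> edges H))"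

definition weak_emb :: "'v ugraph \<Rightarrow> 'w ugraph \<Rightarrow> bool" where
  "weak_emb G H \<longleftrightarrow> (\<exists>K. subgraph K H \<and> graph_iso G K)"

text \<open>
  A cardinal \<open>\<lambda>\<close> is represented by a cardinal order \<open>r\<close> on some type \<open>'a\<close>; the ordinals below
  \<open>\<lambda>\<close> are the elements of \<open>Field r\<close>. Every graph with exactly \<open>\<lambda>\<close> vertices is isomorphic to
  one whose vertices are taken from \<open>'a\<close>, so isomorphism types are represented by the
  isomorphism classes of such graphs.
\<close>

definition graphs_of_card :: "'a rel \<Rightarrow> 'a ugraph set" where
  "graphs_of_card r = {G. in_class_G G \<and> |verts G| =o r}"

definition G_types :: "'a rel \<Rightarrow> 'a ugraph set set" where
  "G_types r = graphs_of_card r //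
     {(G, H). G \<in> graphs_of_card r \<and> H \<in> graphs_of_card r \<and> graph_iso G H}"

definition weak_le :: "'a ugraph set \<Rightarrow> 'a ugraph set \<Rightarrow> bool" where
  "weak_le X Y \<longleftrightarrow> (\<exists>G \<in> X. \<exists>H \<in> Y. weak_emb G H)"

definition real_subsets :: "'a rel \<Rightarrow> real set set" where
  "real_subsets r = {A. |A| \<le>o r}"

definition diagonal_union :: "'a rel \<Rightarrow> ('a \<Rightarrow> 'a set) \<Rightarrow> 'a set" where
  "diagonal_union r A = {\<beta> \<in> Field r. \<exists>\<alpha> \<in> underS r \<beta>. \<beta> \<in> A \<alpha>}"

text \<open>
  As usual for ideals over an infinite cardinal, an ideal is proper and contains all bounded
  sets. Without the latter, already the principal ideal of all sets omitting the ordinal 0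
  would be closed under diagonal unions.
\<close>

definition ideal_over :: "'a rel \<Rightarrow> 'a set set \<Rightarrow> bool" where
  "ideal_over r I \<longleftrightarrow> I \<subseteq> Pow (Field r) \<and> {} \<in> I \<and> Field r \<notin> I \<and>
     (\<forall>A \<in> I. \<forall>B. B \<subseteq> A \<longrightarrow> B \<in> I) \<and>
     (\<forall>A \<in> I. \<forall>B \<in> I. A \<union> B \<in> I) \<and>
     (\<forall>\<gamma> \<in> Field r. under r \<gamma> \<in> I)"

definition normal_ideal :: "'a rel \<Rightarrow> 'a set set \<Rightarrow> bool" where
  "normal_ideal r I \<longleftrightarrow> ideal_over r I \<and>
     (\<forall>A. (\<forall>\<alpha> \<in> Field r. A \<alpha> \<in> I) \<longrightarrow> diagonal_union r A \<in> I)"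

definition power_funs :: "'a rel \<Rightarrow> ('a \<Rightarrow> real set) set" where
  "power_funs r = Field r \<rightarrow>\<^sub>E real_subsets r"

definition reduced_power :: "'a rel \<Rightarrow> 'a set set \<Rightarrow> ('a \<Rightarrow> real set) set set" where
  "reduced_power r I = power_funs r //
     {(f, g). f \<in> power_funs r \<and> g \<in> power_funs r \<and> {\<delta> \<in> Field r. f \<delta> \<noteq> g \<delta>} \<in> I}"

definition reduced_le ::
    "'a rel \<Rightarrow> 'a set set \<Rightarrow> ('a \<Rightarrow> real set) set \<Rightarrow> ('a \<Rightarrow> real set) set \<Rightarrow> bool" where
  "reduced_le r I X Y \<longleftrightarrow>
     (\<exists>f \<in> X. \<exists>g \<in> Y. {\<delta> \<in> Field r. \<not> f \<delta> \<subseteq> g \<delta>} \<in> I)"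

definition qo_hom ::
    "'x set \<Rightarrow> ('x \<Rightarrow> 'x \<Rightarrow> bool) \<Rightarrow> 'y set \<Rightarrow> ('y \<Rightarrow> 'y \<Rightarrow> bool) \<Rightarrow> ('x \<Rightarrow> 'y) \<Rightarrow> bool" where
  "qo_hom P le_P Q le_Q f \<longleftrightarrow> f \<in> P \<rightarrow> Q \<and> monotone_on P le_P le_Q f"

definition qo_surj_hom ::
    "'x set \<Rightarrow> ('x \<Rightarrow> 'x \<Rightarrow> bool) \<Rightarrow> 'y set \<Rightarrow> ('y \<Rightarrow> 'y \<Rightarrow> bool) \<Rightarrow> ('x \<Rightarrow> 'y) \<Rightarrow> bool" where
  "qo_surj_hom P le_P Q le_Q f \<longleftrightarrow> qo_hom P le_P Q le_Q f \<and> f ` P = Q"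

end

theory Submission
  imports Defs "HOL-Library.Countable_Set_Type"
begin

text \<open>
  Let \<open>\<lambda>\<close> be the cardinal. Since \<open>\<lambda> > \<aleph>\<^sub>1\<close> is regular, there is a club guessing sequence: cofinal
  \<open>\<omega>\<close>-sequences \<open>c\<^sub>\<delta>\<close> in certain \<open>\<delta> < \<lambda>\<close> such that every club contains some \<open>c\<^sub>\<delta>\<close>. The sets
  A such that, for some club, no \<open>c\<^sub>\<delta>\<close> with \<open>\<delta>\<close> in A lies in the club up to finitely many terms form a
  normal ideal.
  For a graph on \<open>\<lambda>\<close>, a ray in the neighbourhood of a vertex determines, modulo finite sets, the set of
  all n such that the ray meets the interval between the n-th and (n+1)-st term of \<open>c\<^sub>\<delta>\<close>. As all rays in
  that neighbourhood are tail-equivalent, each vertex codes at most one real at \<open>\<delta>\<close>. An embedding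
  respects a club of initial segments, hence all codes at those \<open>\<delta>\<close> whose \<open>c\<^sub>\<delta>\<close> lies almost inside this
  club, so the sets of coded reals increase modulo the ideal. Every prescribed family of sets of
  reals is realised by the tree of finite sequences of ordinals with one vertex for each
  \<open>\<delta>\<close> and each prescribed real x, joined to the branch along those terms of \<open>c\<^sub>\<delta>\<close> that are selected by x.
\<close>

section \<open>Club guessing\<close>

text \<open>\<open>regularCard\<close> gives every cofinal subset full cardinality, so the small set
  \<open>A\<close> is not cofinal. This yields only a non-strict bound; a strict one exists because
  an infinite cardinal has no largest element.\<close>

lemma regularCard_bounded:
  assumes "Card_order r" "regularCard r" "infinite (Field r)" "A \<subseteq> Field r" "|A| <o r"
  shows "\<exists>b\<in>Field r. \<forall>a\<in>A. (a, b) \<in> r \<and> a \<noteq> b"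
proof -
  have wo: "Well_order r"
    using assms(1) by (simp add: card_order_on_def)
  then interpret wo_rel r
    by (simp add: wo_rel_def)
  have "\<not> cofinal A r"
    using assms(2,4,5) not_ordLess_ordIso unfolding regularCard_def by blast
  then obtain b where b: "b \<in> Field r" "\<forall>a\<in>A. b = a \<or> (b, a) \<notin> r"
    unfolding cofinal_def by blast
  obtain b' where b': "b \<noteq> b'" "(b, b') \<in> r"
    using infinite_Card_order_limit[OF assms(1,3) b(1)] by blast
  have "(a, b) \<in> r" if "a \<in> A" for a
    using b that assms(4) TOTALS REFL unfolding refl_on_def by (metis subsetD)
  then have "(a, b') \<in> r \<and> a \<noteq> b'" if "a \<in> A" for a
    using b' that TRANS ANTISYM by (metis antisymD transD)
  then show ?thesis
    using b' FieldI2 by metis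
qed

section \<open>Order and boundedness in a regular cardinal above aleph_1\<close>

locale regular_cardinal =
  fixes r :: "'a rel"
  assumes card_order: "Card_order r"
    and regular: "regularCard r"
    and gt_aleph1: "cardSuc natLeq <o r"
begin

text \<open>Reflexive outside \<open>Field r\<close> as well, so that the locale
  \<open>order\<close> applies to the whole type; comparability is available only on
  \<open>Field r\<close>.\<close>

definition le (infix "\<preceq>" 50) where
  "a \<preceq> b \<longleftrightarrow> a = b \<or> (a, b) \<in> r"

definition lt (infix "\<prec>" 50) where
  "a \<prec> b \<longleftrightarrow> (a, b) \<in> r \<and> a \<noteq> b"

lemma well_order: "Well_order r"
  using card_order by (simp add: card_order_on_def)

interpretation wo: wo_rel r
  by (simp add: wo_rel_def well_order)

sublocale ord: order le lt
proof
  show "x \<prec> y \<longleftrightarrow> x \<preceq> y \<and> \<not> y \<preceq> x" for x y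
    using wo.ANTISYM unfolding le_def lt_def by (metis antisymD)
  show "x \<preceq> z" if "x \<preceq> y" "y \<preceq> z" for x y z
    using that wo.TRANS unfolding le_def by (metis transD)
  show "x = y" if "x \<preceq> y" "y \<preceq> x" for x y
    using that wo.ANTISYM unfolding le_def by (metis antisymD)
qed (simp add: le_def)

lemma lt_Field: "a \<prec> b \<Longrightarrow> a \<in> Field r" "a \<prec> b \<Longrightarrow> b \<in> Field r"
  by (auto simp: lt_def Field_def)

lemma le_Field: "a \<preceq> b \<Longrightarrow> b \<in> Field r \<Longrightarrow> a \<in> Field r" "a \<preceq> b \<Longrightarrow> a \<in> Field r \<Longrightarrow> b \<in> Field r"
  by (auto simp: le_def Field_def)

lemma linear: "a \<in> Field r \<Longrightarrow> b \<in> Field r \<Longrightarrow> a \<prec> b \<or> b \<preceq> a"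
  using wo.TOTALS unfolding le_def lt_def by blast

lemma least_element:
  assumes "A \<subseteq> Field r" "A \<noteq> {}"
  obtains m where "m \<in> A" "\<And>a. a \<in> A \<Longrightarrow> m \<preceq> a"
  using wo.minim_in[OF assms] wo.minim_least[OF assms(1)] le_def by blast

lemma natLeq_less: "natLeq <o r"
  using ordLess_transitive[OF cardSuc_greater[OF natLeq_Card_order] gt_aleph1] .

lemma infinite_Field: "infinite (Field r)"
  using ordLeq_ordIso_trans[OF ordLess_imp_ordLeq[OF natLeq_less]
      ordIso_symmetric[OF card_of_Field_ordIso[OF card_order]]]
  by (metis infinite_iff_natLeq_ordLeq)

lemma countable_small: "countable A \<Longrightarrow> |A| <o r"
  using ordLeq_ordLess_trans[OF _ natLeq_less] by (simp add: countable_card_le_natLeq)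

lemma bounded:
  assumes "A \<subseteq> Field r" "|A| <o r"
  obtains b where "b \<in> Field r" "\<And>a. a \<in> A \<Longrightarrow> a \<prec> b"
  using regularCard_bounded[OF card_order regular infinite_Field assms] lt_def by blast

lemma bounded_image:
  assumes "f ` A \<subseteq> Field r" "|A| <o r"
  obtains b where "b \<in> Field r" "\<And>a. a \<in> A \<Longrightarrow> f a \<prec> b"
proof -
  from bounded[OF assms(1) ordLeq_ordLess_trans[OF card_of_image assms(2)]]
  obtain b where "b \<in> Field r" "\<And>a. a \<in> f ` A \<Longrightarrow> a \<prec> b"
    by blast
  then show ?thesis
    using that by (metis imageI)
qed

lemma initial_small:
  assumes "a \<in> Field r"
  shows "|{b. b \<preceq> a}| <o r"
proof -
  obtain c where c: "a \<prec> c"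
    using infinite_Card_order_limit[OF card_order infinite_Field assms] lt_def by blast
  have "{b. b \<preceq> a} \<subseteq> underS r c"
    using ord.le_less_trans[OF _ c] unfolding underS_def lt_def by blast
  then show ?thesis
    using card_of_underS[OF card_order lt_Field(2)[OF c]]
    by (rule ordLeq_ordLess_trans[OF card_of_mono1])
qed

text \<open>The closure points of functions on the cardinal form a base of the club filter; they
  replace closed unbounded sets throughout.\<close>

definition closure_points :: "('a \<Rightarrow> 'a) \<Rightarrow> 'a set" where
  "closure_points K = {\<delta> \<in> Field r. \<forall>\<beta>. \<beta> \<prec> \<delta> \<longrightarrow> K \<beta> \<prec> \<delta>}"

text \<open>The points that admit a ladder are the limit ordinals of cofinality omega.\<close>

definition ladder :: "(nat \<Rightarrow> 'a) \<Rightarrow> 'a \<Rightarrow> bool" where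
  "ladder e \<delta> \<longleftrightarrow> (\<forall>n. e n \<prec> e (Suc n)) \<and> (\<forall>n. e n \<prec> \<delta>) \<and> (\<forall>\<beta>. \<beta> \<prec> \<delta> \<longrightarrow> (\<exists>n. \<beta> \<prec> e n))"

lemma closure_points_antimono:
  assumes "\<And>\<beta>. \<beta> \<in> Field r \<Longrightarrow> K \<beta> \<preceq> K' \<beta>"
  shows "closure_points K' \<subseteq> closure_points K"
  using assms lt_Field ord.le_less_trans unfolding closure_points_def by blast

text \<open>Regularity bounds the fewer than lambda many values at each argument. Together with
  \<open>closure_points_antimono\<close> this replaces the intersection of fewer than lambda many
  clubs.\<close>

lemma join:
  assumes "|J| <o r" "\<And>i. i \<in> J \<Longrightarrow> K i \<in> Field r \<rightarrow> Field r"
  obtains L where "L \<in> Field r \<rightarrow> Field r" "\<And>i \<beta>. i \<in> J \<Longrightarrow> \<beta> \<in> Field r \<Longrightarrow> K i \<beta> \<preceq> L \<beta>"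
proof -
  have "\<exists>b\<in>Field r. \<forall>i\<in>J. K i \<beta> \<preceq> b" if "\<beta> \<in> Field r" for \<beta>
  proof -
    have "(\<lambda>i. K i \<beta>) ` J \<subseteq> Field r"
      using assms(2) that by blast
    then obtain b where "b \<in> Field r" "\<And>i. i \<in> J \<Longrightarrow> K i \<beta> \<prec> b"
      using bounded_image[OF _ assms(1)] by blast
    then show ?thesis
      using ord.less_imp_le by blast
  qed
  then obtain L where "\<forall>\<beta>\<in>Field r. L \<beta> \<in> Field r \<and> (\<forall>i\<in>J. K i \<beta> \<preceq> L \<beta>)"
    by metis
  then show ?thesis
    using that by blast
qed

text \<open>Regularity bounds a countable sequence; a strictly increasing one is cofinal in its
  least upper bound.\<close>

lemma ladder_exists:
  assumes "\<And>n. e n \<prec> e (Suc n)"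
  obtains \<delta> where "ladder e \<delta>"
proof -
  define U where "U = {b \<in> Field r. \<forall>n. e n \<prec> b}"
  have e: "range e \<subseteq> Field r"
    using assms lt_Field by blast
  have "|UNIV :: nat set| <o r"
    by (rule countable_small) simp
  from bounded_image[OF e this] obtain b where "b \<in> Field r" "\<And>n. n \<in> UNIV \<Longrightarrow> e n \<prec> b"
    by blast
  then have U: "U \<subseteq> Field r" "U \<noteq> {}"
    unfolding U_def by blast+
  from least_element[OF U] obtain m where m: "m \<in> U" "\<And>a. a \<in> U \<Longrightarrow> m \<preceq> a"
    by blast
  have "\<exists>n. \<beta> \<prec> e n" if "\<beta> \<prec> m" for \<beta>
  proof -
    have "\<beta> \<notin> U"
      using m(2) that ord.leD by blast
    then obtain n where "\<not> e n \<prec> \<beta>"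
      using that lt_Field unfolding U_def by blast
    then have "\<beta> \<preceq> e n"
      using linear e that lt_Field by blast
    then show ?thesis
      using assms ord.le_less_trans by blast
  qed
  then show ?thesis
    using that assms m(1) unfolding ladder_def U_def by blast
qed

lemma ladder_strict_mono:
  assumes "ladder e \<delta>" "m < n"
  shows "e m \<prec> e n"
  using assms(2)
proof (induction n)
  case (Suc n)
  then show ?case
    using assms(1) unfolding ladder_def by (metis less_SucE ord.less_trans)
qed simp

lemma ladder_mono: "ladder e \<delta> \<Longrightarrow> m \<le> n \<Longrightarrow> e m \<preceq> e n"
  using ladder_strict_mono le_def ord.less_imp_le by (metis le_neq_implies_less)

text \<open>Climb omega many steps, each going beyond all values of \<open>K\<close> on the initial
  segment reached so far; the supremum is then closed under \<open>K\<close>.\<close>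

lemma closure_points_unbounded:
  assumes "K \<in> Field r \<rightarrow> Field r" "a \<in> Field r"
  obtains \<delta> where "\<delta> \<in> closure_points K" "a \<prec> \<delta>"
proof -
  have "\<exists>b. x \<prec> b \<and> (\<forall>\<beta>. \<beta> \<preceq> x \<longrightarrow> K \<beta> \<prec> b)" if x: "x \<in> Field r" for x
  proof -
    have "K ` {b. b \<preceq> x} \<subseteq> Field r"
      using assms(1) le_Field(1)[OF _ x] by auto
    then obtain b where b: "b \<in> Field r" "\<And>\<beta>. \<beta> \<in> {b. b \<preceq> x} \<Longrightarrow> K \<beta> \<prec> b"
      using bounded_image[OF _ initial_small[OF x]] by blast
    obtain b' where b': "b' \<in> Field r" "x \<prec> b'"
      using infinite_Card_order_limit[OF card_order infinite_Field x] lt_def by blast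
    show ?thesis
      using linear[OF b(1) b'(1)] b b' ord.less_trans ord.less_le_trans by blast
  qed
  then obtain e where e: "e 0 = a" "\<And>n. e n \<in> Field r"
    "\<And>n. e n \<prec> e (Suc n) \<and> (\<forall>\<beta>. \<beta> \<preceq> e n \<longrightarrow> K \<beta> \<prec> e (Suc n))"
    using dependent_nat_choice[of "\<lambda>n x. x \<in> Field r \<and> (n = 0 \<longrightarrow> x = a)"
        "\<lambda>n x y. x \<prec> y \<and> (\<forall>\<beta>. \<beta> \<preceq> x \<longrightarrow> K \<beta> \<prec> y)"] assms(2) lt_Field(2)
    by (metis nat.distinct(1))
  obtain \<delta> where d: "ladder e \<delta>"
    using ladder_exists e(3) by blast
  have "K \<beta> \<prec> \<delta>" if "\<beta> \<prec> \<delta>" for \<beta>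
    using that d e(3) unfolding ladder_def by (meson ord.less_imp_le ord.less_trans)
  moreover have "a \<prec> \<delta>"
    using d e(1) unfolding ladder_def by blast
  ultimately show ?thesis
    using that lt_Field unfolding closure_points_def by blast
qed

text \<open>The gluing operation of club guessing: a rung of a ladder is pushed down to the nearest
  closure point. There always is one, since the least ordinal is vacuously a closure point.\<close>

definition last_point :: "('a \<Rightarrow> 'a) \<Rightarrow> 'a \<Rightarrow> 'a" where
  "last_point K \<gamma> = (SOME m. m \<in> closure_points K \<and> m \<preceq> \<gamma> \<and>
     (\<forall>m'\<in>closure_points K. m' \<preceq> \<gamma> \<longrightarrow> m' \<preceq> m))"

text \<open>Closure points are closed under suprema: any \<beta> below the least upper bound
  \<open>m\<close> lies below some closure point \<open>d\<close> at or below \<gamma>, so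
  \<open>K \<beta>\<close> stays below \<open>d\<close> and hence below \<open>m\<close>.\<close>

lemma last_point:
  assumes "\<gamma> \<in> Field r"
  shows "last_point K \<gamma> \<in> closure_points K" "last_point K \<gamma> \<preceq> \<gamma>"
    "\<And>m. m \<in> closure_points K \<Longrightarrow> m \<preceq> \<gamma> \<Longrightarrow> m \<preceq> last_point K \<gamma>"
proof -
  define U where "U = {a \<in> Field r. \<forall>m\<in>closure_points K. m \<preceq> \<gamma> \<longrightarrow> m \<preceq> a}"
  have "\<gamma> \<in> U" and U: "U \<subseteq> Field r"
    using assms unfolding U_def by blast+
  then have "U \<noteq> {}"
    by blast
  from least_element[OF U this] obtain m where m: "m \<in> U" "\<And>a. a \<in> U \<Longrightarrow> m \<preceq> a"
    by blast
  have "K \<beta> \<prec> m" if \<beta>: "\<beta> \<prec> m" for \<beta>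
  proof -
    have "\<beta> \<notin> U"
      using m(2) \<beta> ord.leD by blast
    then obtain d where d: "d \<in> closure_points K" "d \<preceq> \<gamma>" "\<not> d \<preceq> \<beta>"
      using lt_Field(1)[OF \<beta>] unfolding U_def by blast
    then have "\<beta> \<prec> d"
      using linear[of \<beta> d] lt_Field(1)[OF \<beta>] unfolding closure_points_def by blast
    then have "K \<beta> \<prec> d"
      using d(1) unfolding closure_points_def by blast
    then show ?thesis
      using m(1) d ord.less_le_trans unfolding U_def by blast
  qed
  then have "\<exists>m. m \<in> closure_points K \<and> m \<preceq> \<gamma> \<and>
     (\<forall>m'\<in>closure_points K. m' \<preceq> \<gamma> \<longrightarrow> m' \<preceq> m)"
    using m \<open>\<gamma> \<in> U\<close> unfolding U_def closure_points_def by blast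
  from someI_ex[OF this]
  show "last_point K \<gamma> \<in> closure_points K" "last_point K \<gamma> \<preceq> \<gamma>"
    "\<And>m. m \<in> closure_points K \<Longrightarrow> m \<preceq> \<gamma> \<Longrightarrow> m \<preceq> last_point K \<gamma>"
    unfolding last_point_def by auto
qed

lemma last_point_antimono:
  assumes "\<gamma> \<in> Field r" "closure_points K' \<subseteq> closure_points K"
  shows "last_point K' \<gamma> \<preceq> last_point K \<gamma>"
  using last_point[OF assms(1)] assms(2) by blast

text \<open>If every function K had a witness N K against guessing, iterate N along the first
  uncountable cardinal. For fixed \<open>\<delta>\<close> each of the countably many decreasing sequences of
  last closure points below the rungs of \<open>\<delta>\<close> stabilises at a countable stage, so all of them are
  stable from one countable stage on, where the witness fails.\<close>

lemma guessing_function: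
  assumes ladders: "\<And>\<delta> e. ladder e \<delta> \<Longrightarrow> ladder (c \<delta>) \<delta>"
  shows "\<exists>K\<in>Field r \<rightarrow> Field r. \<forall>K'\<in>Field r \<rightarrow> Field r. \<exists>\<delta>. ladder (c \<delta>) \<delta> \<and>
     (\<forall>\<beta>. \<beta> \<prec> \<delta> \<longrightarrow> (\<exists>n. \<beta> \<prec> last_point K (c \<delta> n))) \<and>
     (\<forall>n. last_point K (c \<delta> n) \<in> closure_points K')"
proof (rule ccontr)
  define P where "P K K' \<longleftrightarrow> (\<exists>\<delta>. ladder (c \<delta>) \<delta> \<and>
       (\<forall>\<beta>. \<beta> \<prec> \<delta> \<longrightarrow> (\<exists>n. \<beta> \<prec> last_point K (c \<delta> n))) \<and>
       (\<forall>n. last_point K (c \<delta> n) \<in> closure_points K'))" for K K'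
  define FF where "FF = Field r \<rightarrow> Field r"
  assume "\<not> ?thesis"
  then have neg: "\<exists>K'\<in>FF. \<not> P K K'" if "K \<in> FF" for K
    using that unfolding P_def FF_def by blast
  note join = join[folded FF_def]
  \<comment> \<open>Enlarging a witness against guessing keeps it a witness, because its closure
    points only become fewer. Taking it above \<open>K\<close> makes the iteration produce
    decreasing sets of closure points.\<close>
  have "\<exists>L\<in>FF. (\<forall>\<beta>\<in>Field r. K \<beta> \<preceq> L \<beta>) \<and> \<not> P K L" if K: "K \<in> FF" for K
  proof -
    obtain K' where K': "K' \<in> FF" "\<not> P K K'"
      using neg[OF K] by blast
    have "|{K, K'}| <o r"
      by (rule countable_small) simp
    then obtain L where L: "L \<in> FF" "\<And>i \<beta>. i \<in> {K, K'} \<Longrightarrow> \<beta> \<in> Field r \<Longrightarrow> i \<beta> \<preceq> L \<beta>"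
      using join[of "{K, K'}" "\<lambda>i. i"] K K' by blast
    have "closure_points L \<subseteq> closure_points K'"
      using L(2) by (intro closure_points_antimono) blast
    then have "\<not> P K L"
      using K'(2) unfolding P_def by blast
    then show ?thesis
      using L by blast
  qed
  then obtain N where N: "\<And>K. K \<in> FF \<Longrightarrow> N K \<in> FF"
    "\<And>K \<beta>. K \<in> FF \<Longrightarrow> \<beta> \<in> Field r \<Longrightarrow> K \<beta> \<preceq> N K \<beta>" "\<And>K. K \<in> FF \<Longrightarrow> \<not> P K (N K)"
    by metis
  define w where "w = cardSuc natLeq"
  have wC: "Card_order w"
    unfolding w_def by (simp add: cardSuc_Card_order natLeq_Card_order)
  then have wW: "Well_order w"
    by (simp add: card_order_on_def)
  then interpret w: wo_rel w
    by (simp add: wo_rel_def)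
  have winf: "infinite (Field w)"
    unfolding w_def using natLeq_Card_order Field_natLeq cardSuc_finite by (metis infinite_UNIV_nat)
  have wreg: "regularCard w"
    unfolding w_def using natLeq_Card_order Field_natLeq infinite_cardSuc_regularCard
    by (metis infinite_UNIV_nat)
  have wF: "|Field w| <o r"
    using ordIso_ordLess_trans[OF card_of_Field_ordIso[OF wC]] gt_aleph1 unfolding w_def by blast
  have "\<exists>f. \<forall>i. (f i \<in> FF \<and> (\<forall>j. (j, i) \<in> w - Id \<longrightarrow> (\<forall>\<beta>\<in>Field r. N (f j) \<beta> \<preceq> f i \<beta>)))"
  proof (rule dependent_wf_choice[where P = "\<lambda>f i k. k \<in> FF \<and>
        (\<forall>j. (j, i) \<in> w - Id \<longrightarrow> (\<forall>\<beta>\<in>Field r. N (f j) \<beta> \<preceq> k \<beta>))"])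
    show "wf (w - Id)"
      using w.WF .
  next
    fix i and f :: "nat set \<Rightarrow> 'a \<Rightarrow> 'a"
    assume IH: "\<And>y. (y, i) \<in> w - Id \<Longrightarrow> f y \<in> FF \<and>
      (\<forall>j. (j, y) \<in> w - Id \<longrightarrow> (\<forall>\<beta>\<in>Field r. N (f j) \<beta> \<preceq> f y \<beta>))"
    have "{j. (j, i) \<in> w - Id} \<subseteq> Field w"
      by (auto simp: Field_def)
    then have "|{j. (j, i) \<in> w - Id}| <o r"
      by (rule ordLeq_ordLess_trans[OF card_of_mono1 wF])
    then obtain L where "L \<in> FF" "\<And>j \<beta>. (j, i) \<in> w - Id \<Longrightarrow> \<beta> \<in> Field r \<Longrightarrow> N (f j) \<beta> \<preceq> L \<beta>"
      using join[of "{j. (j, i) \<in> w - Id}" "\<lambda>j. N (f j)"] IH N(1) by (metis mem_Collect_eq)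
    then show "\<exists>k. k \<in> FF \<and> (\<forall>j. (j, i) \<in> w - Id \<longrightarrow> (\<forall>\<beta>\<in>Field r. N (f j) \<beta> \<preceq> k \<beta>))"
      by blast
  qed simp
  then obtain f where "\<forall>i. (f i \<in> FF \<and> (\<forall>j. (j, i) \<in> w - Id \<longrightarrow> (\<forall>\<beta>\<in>Field r. N (f j) \<beta> \<preceq> f i \<beta>)))" ..
  then have f: "\<And>i. f i \<in> FF"
    "\<And>i j \<beta>. (j, i) \<in> w - Id \<Longrightarrow> \<beta> \<in> Field r \<Longrightarrow> N (f j) \<beta> \<preceq> f i \<beta>"
    by blast+
  have sub: "closure_points (f i) \<subseteq> closure_points (N (f j))" if "(j, i) \<in> w - Id" for i j
    using f(2)[OF that] by (rule closure_points_antimono)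
  have "closure_points (N (f j)) \<subseteq> closure_points (f j)" for j
    using N(2) f(1) by (intro closure_points_antimono) blast
  then have sub': "closure_points (f i) \<subseteq> closure_points (f j)" if "(j, i) \<in> w - Id" for i j
    using sub[OF that] by blast
  \<comment> \<open>All stages are bounded at once; this is possible because aleph_1 is smaller than
    the regular cardinal.\<close>
  obtain L where L: "L \<in> FF" "\<And>i \<beta>. i \<in> Field w \<Longrightarrow> \<beta> \<in> Field r \<Longrightarrow> f i \<beta> \<preceq> L \<beta>"
    using join[OF wF, of f] f(1) by blast
  have subL: "closure_points L \<subseteq> closure_points (f i)" if "i \<in> Field w" for i
    using L(2)[OF that] by (rule closure_points_antimono)
  have "\<exists>y. y \<in> closure_points L \<and> x \<prec> y" if "x \<in> closure_points L" for x
  proof -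
    have "x \<in> Field r"
      using that unfolding closure_points_def by blast
    from closure_points_unbounded[OF L(1)[unfolded FF_def] this] show ?thesis
      by blast
  qed
  moreover obtain a where "a \<in> Field r"
    using infinite_Field by fastforce
  from closure_points_unbounded[OF L(1)[unfolded FF_def] this] have "\<exists>x. x \<in> closure_points L"
    by blast
  \<comment> \<open>The point \<delta> is chosen as a limit of closure points of \<open>L\<close>.
    These are closure points at every stage, so gluing the rungs of \<open>c \<delta>\<close> leaves
    them cofinal in \<delta> at every stage.\<close>
  ultimately obtain e where e: "\<And>n. e n \<in> closure_points L" "\<And>n. e n \<prec> e (Suc n)"
    using dependent_nat_choice[of "\<lambda>_ x. x \<in> closure_points L" "\<lambda>_ x y. x \<prec> y"] by metis
  then obtain \<delta> where e\<delta>: "ladder e \<delta>"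
    using ladder_exists by blast
  then have c\<delta>: "ladder (c \<delta>) \<delta>"
    by (rule ladders)
  then have cF: "c \<delta> n \<in> Field r" for n
    using lt_Field unfolding ladder_def by blast
  have "\<exists>i\<in>Field w. \<forall>j\<in>Field w. last_point (f i) (c \<delta> n) \<preceq> last_point (f j) (c \<delta> n)" for n
  proof -
    have "(\<lambda>i. last_point (f i) (c \<delta> n)) ` Field w \<subseteq> Field r"
      using last_point(1)[OF cF] unfolding closure_points_def by blast
    moreover have "Field w \<noteq> {}"
      using winf by auto
    ultimately show ?thesis
      using least_element[of "(\<lambda>i. last_point (f i) (c \<delta> n)) ` Field w"]
      by (smt (verit, best) image_iff image_is_empty)
  qed
  then obtain i where i: "\<And>n. i n \<in> Field w"
    "\<And>n j. j \<in> Field w \<Longrightarrow> last_point (f (i n)) (c \<delta> n) \<preceq> last_point (f j) (c \<delta> n)"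
    by metis
  have "|range i| \<le>o natLeq"
    by (rule ordLeq_ordIso_trans[OF card_of_image card_of_nat])
  then have "|range i| <o w"
    unfolding w_def by (rule ordLeq_ordLess_trans[OF _ cardSuc_greater[OF natLeq_Card_order]])
  moreover have "range i \<subseteq> Field w"
    using i(1) by blast
  ultimately have "\<exists>b\<in>Field w. \<forall>a\<in>range i. (a, b) \<in> w \<and> a \<noteq> b"
    using regularCard_bounded[OF wC wreg winf] by blast
  then obtain i' where i': "i' \<in> Field w" "\<forall>a\<in>range i. (a, i') \<in> w \<and> a \<noteq> i'" ..
  then have ii': "(i n, i') \<in> w - Id" for n
    by simp
  obtain j where j: "(i', j) \<in> w - Id" "j \<in> Field w"
    using infinite_Card_order_limit[OF wC winf i'(1)] by blast
  \<comment> \<open>Stage \<open>i'\<close> lies beyond all stabilisation stages \<open>i n\<close>,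
    so its last points coincide with those of the later stage \<open>j\<close>, which are closure
    points of the witness \<open>N (f i')\<close>.\<close>
  have "last_point (f i') (c \<delta> n) \<in> closure_points (N (f i'))" for n
  proof -
    have "last_point (f i') (c \<delta> n) \<preceq> last_point (f (i n)) (c \<delta> n)"
      using last_point_antimono[OF cF sub'[OF ii']] .
    also have "\<dots> \<preceq> last_point (f j) (c \<delta> n)"
      using i(2) j(2) by blast
    finally have "last_point (f i') (c \<delta> n) = last_point (f j) (c \<delta> n)"
      using last_point_antimono[OF cF sub'[OF j(1)]] ord.order_antisym by blast
    then show ?thesis
      using last_point(1)[OF cF] sub[OF j(1)] by (metis subsetD)
  qed
  moreover have "\<exists>n. \<beta> \<prec> last_point (f i') (c \<delta> n)" if \<beta>: "\<beta> \<prec> \<delta>" for \<beta>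
  proof -
    obtain n where n: "\<beta> \<prec> e n" "e n \<prec> \<delta>"
      using \<beta> e\<delta> unfolding ladder_def by blast
    then obtain m where "e n \<prec> c \<delta> m"
      using c\<delta> unfolding ladder_def by blast
    then have "e n \<preceq> last_point (f i') (c \<delta> m)"
      using last_point(3)[OF cF] e(1) subL[OF i'(1)] ord.less_imp_le by blast
    then show ?thesis
      using n(1) ord.less_le_trans by blast
  qed
  ultimately have "P (f i') (N (f i'))"
    using c\<delta> unfolding P_def by blast
  then show False
    using N(3) f(1) by blast
qed

text \<open>Thin out the sequence: each new term is chosen above both the previous choice and the
  current \<open>e n\<close>, which gives strict increase and keeps cofinality.\<close>

lemma ladder_from_cofinal:
  fixes e :: "nat \<Rightarrow> 'a"
  assumes "\<And>n. e n \<prec> \<delta>" "\<And>\<beta>. \<beta> \<prec> \<delta> \<Longrightarrow> \<exists>n. \<beta> \<prec> e n"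
  shows "\<exists>d. ladder d \<delta> \<and> range d \<subseteq> range e"
proof -
  have "\<exists>y. y \<in> range e \<and> (x \<prec> y \<and> e n \<prec> y)" if x: "x \<in> range e" for n x
  proof -
    have "\<exists>z. (z = x \<or> z = e n) \<and> x \<preceq> z \<and> e n \<preceq> z"
      using linear[of x "e n"] x assms(1) lt_Field(1) ord.less_imp_le by blast
    then obtain z where z: "z \<prec> \<delta>" "x \<preceq> z" "e n \<preceq> z"
      using x assms(1) by blast
    then show ?thesis
      using assms(2)[OF z(1)] ord.le_less_trans by blast
  qed
  then obtain d where d: "\<And>n. d n \<in> range e" "\<And>n. d n \<prec> d (Suc n) \<and> e n \<prec> d (Suc n)"
    using dependent_nat_choice[of "\<lambda>_ x. x \<in> range e" "\<lambda>n x y. x \<prec> y \<and> e n \<prec> y"] by (metis rangeI)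
  have "d n \<prec> \<delta>" for n
    using d(1) assms(1) by (metis rangeE)
  moreover have "\<exists>n. \<beta> \<prec> d n" if "\<beta> \<prec> \<delta>" for \<beta>
    using assms(2)[OF that] d(2) ord.less_trans by blast
  ultimately have "ladder d \<delta>"
    using d(2) unfolding ladder_def by blast
  then show ?thesis
    using d(1) by (intro exI[of _ d]) blast
qed

text \<open>With \<open>K\<close> from \<open>guessing_function\<close>, glue the rungs of the
  chosen ladders onto closure points of \<open>K\<close> and keep those \<delta> where the glued
  points remain cofinal. Glued points may repeat, so they are thinned out to ladders.\<close>

proposition club_guessing:
  "\<exists>S c. (\<forall>\<delta>\<in>S. ladder (c \<delta>) \<delta>) \<and>
     (\<forall>K\<in>Field r \<rightarrow> Field r. \<exists>\<delta>\<in>S. range (c \<delta>) \<subseteq> closure_points K)"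
proof -
  define c where "c \<delta> = (SOME e. ladder e \<delta>)" for \<delta>
  have "ladder (c \<delta>) \<delta>" if "ladder e \<delta>" for e \<delta>
    unfolding c_def by (rule someI[of "\<lambda>e. ladder e \<delta>", OF that])
  then obtain K where K: "K \<in> Field r \<rightarrow> Field r"
    "\<forall>K'\<in>Field r \<rightarrow> Field r. \<exists>\<delta>. ladder (c \<delta>) \<delta> \<and>
       (\<forall>\<beta>. \<beta> \<prec> \<delta> \<longrightarrow> (\<exists>n. \<beta> \<prec> last_point K (c \<delta> n))) \<and>
       (\<forall>n. last_point K (c \<delta> n) \<in> closure_points K')"
    using guessing_function[of c] by meson
  define S where "S = {\<delta>. ladder (c \<delta>) \<delta> \<and> (\<forall>\<beta>. \<beta> \<prec> \<delta> \<longrightarrow> (\<exists>n. \<beta> \<prec> last_point K (c \<delta> n)))}"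
  have "\<exists>d. ladder d \<delta> \<and> range d \<subseteq> range (\<lambda>n. last_point K (c \<delta> n))" if \<delta>: "\<delta> \<in> S" for \<delta>
  proof -
    have "last_point K (c \<delta> n) \<prec> \<delta>" for n
      using \<delta> last_point(2) lt_Field ord.le_less_trans unfolding S_def ladder_def by blast
    moreover have "\<exists>n. \<beta> \<prec> last_point K (c \<delta> n)" if "\<beta> \<prec> \<delta>" for \<beta>
      using \<delta> that unfolding S_def by blast
    ultimately show ?thesis
      by (rule ladder_from_cofinal)
  qed
  then obtain d where d: "\<And>\<delta>. \<delta> \<in> S \<Longrightarrow> ladder (d \<delta>) \<delta>"
    "\<And>\<delta>. \<delta> \<in> S \<Longrightarrow> range (d \<delta>) \<subseteq> range (\<lambda>n. last_point K (c \<delta> n))"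
    by metis
  have "\<exists>\<delta>\<in>S. range (d \<delta>) \<subseteq> closure_points K'" if K': "K' \<in> Field r \<rightarrow> Field r" for K'
  proof -
    obtain \<delta> where \<delta>: "\<delta> \<in> S" "\<And>n. last_point K (c \<delta> n) \<in> closure_points K'"
      using bspec[OF K(2) K'] unfolding S_def by blast
    then have "range (\<lambda>n. last_point K (c \<delta> n)) \<subseteq> closure_points K'"
      by blast
    then show ?thesis
      using subset_trans[OF d(2)[OF \<delta>(1)]] \<delta>(1) by blast
  qed
  then show ?thesis
    using d(1) by (intro exI[of _ S] exI[of _ d]) simp
qed

end

section \<open>Rays and branch graphs\<close>

definition ray_of :: "(nat \<Rightarrow> 'v) \<Rightarrow> 'v ugraph" where
  "ray_of p = \<lparr>verts = range p, edges = range (\<lambda>n. {p n, p (Suc n)})\<rparr>"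

lemma verts_ray_of [simp]: "verts (ray_of p) = range p"
  and edges_ray_of [simp]: "edges (ray_of p) = range (\<lambda>n. {p n, p (Suc n)})"
  by (simp_all add: ray_of_def)

lemma is_ray_iff: "is_ray R \<longleftrightarrow> (\<exists>p. inj p \<and> R = ray_of p)"
  unfolding is_ray_def ray_of_def by (cases R) simp

lemma is_graph_ray_of: "inj p \<Longrightarrow> is_graph (ray_of p)"
  unfolding is_graph_def by (auto simp: card_insert_if inj_eq)

lemma connected_ray_of: "connected_graph (ray_of p)"
proof -
  define E where "E = {(x, y). {x, y} \<in> edges (ray_of p)}"
  have E: "(p n, p (Suc n)) \<in> E" "(p (Suc n), p n) \<in> E" for n
    unfolding E_def by (auto simp: insert_commute)
  have "(p 0, p n) \<in> E\<^sup>* \<and> (p n, p 0) \<in> E\<^sup>*" for n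
  proof (induction n)
    case (Suc n)
    then show ?case
      using E[of n] by (meson converse_rtrancl_into_rtrancl rtrancl.rtrancl_into_rtrancl)
  qed simp
  then show ?thesis
    unfolding connected_graph_def E_def[symmetric] by (auto intro: rtrancl_trans)
qed

text \<open>If \<open>T\<close> contains \<open>p m\<close> and omits the edge after
  \<open>p n\<close> for some \<open>n \<ge> m\<close>, connectedness confines \<open>T\<close> to
  the first \<open>n + 1\<close> vertices of the ray, so \<open>T\<close> is finite.\<close>

lemma infinite_connected_subgraph_of_ray:
  assumes p: "inj p" and T: "subgraph T (ray_of p)" "connected_graph T" "infinite (verts T)"
  obtains N where "\<And>n. n \<ge> N \<Longrightarrow> p n \<in> verts T" "\<And>n. n \<ge> N \<Longrightarrow> {p n, p (Suc n)} \<in> edges T"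
proof -
  have verts: "verts T \<subseteq> range p" and edges: "edges T \<subseteq> range (\<lambda>n. {p n, p (Suc n)})"
    using T(1) unfolding subgraph_def by auto
  obtain m where m: "p m \<in> verts T"
    using T(3) verts by (metis finite.emptyI ex_in_conv rangeE subsetD)
  have e: "{p n, p (Suc n)} \<in> edges T" if n: "n \<ge> m" for n
  proof (rule ccontr)
    assume neg: "{p n, p (Suc n)} \<notin> edges T"
    have step: "y \<in> p ` {..n}" if xy: "{x, y} \<in> edges T" and x: "x \<in> p ` {..n}" for x y
    proof -
      obtain k where k: "{x, y} = {p k, p (Suc k)}"
        using xy edges by blast
      obtain i where i: "x = p i" "i \<le> n"
        using x by blast
      have "k \<noteq> n"
        using k xy neg by auto
      moreover have "(x = p k \<and> y = p (Suc k)) \<or> (x = p (Suc k) \<and> y = p k)"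
        using k by (auto simp: doubleton_eq_iff)
      ultimately show ?thesis
        using i injD[OF p] by (metis Suc_leD Suc_leI atMost_iff image_eqI le_neq_implies_less)
    qed
    have "y \<in> p ` {..n}" if "(p m, y) \<in> {(x, y). {x, y} \<in> edges T}\<^sup>*" for y
      using that
    proof (induction rule: rtrancl_induct)
      case base
      then show ?case
        using n by simp
    next
      case (step y z)
      then show ?case
        using \<open>\<And>x y. {x, y} \<in> edges T \<Longrightarrow> x \<in> p ` {..n} \<Longrightarrow> y \<in> p ` {..n}\<close> by blast
    qed
    then have "verts T \<subseteq> p ` {..n}"
      using T(2) m unfolding connected_graph_def by blast
    then show False
      using T(3) finite_subset by blast
  qed
  moreover have "p n \<in> verts T" if "n \<ge> m" for n
    using e[OF that] T(1) unfolding subgraph_def is_graph_def by blast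
  ultimately show ?thesis
    using that by blast
qed

text \<open>The shared infinite connected subgraph contains a whole tail of \<open>R\<close>, so
  only an initial piece of \<open>R\<close> can miss \<open>S\<close>.\<close>

lemma tail_equivalent_finite_diff:
  assumes "is_ray R" "tail_equivalent R S"
  shows "finite (verts R - verts S)"
proof -
  obtain p where p: "inj p" "R = ray_of p"
    using assms(1) is_ray_iff by blast
  obtain T where T: "infinite (verts T)" "connected_graph T" "subgraph T R" "subgraph T S"
    using assms(2) unfolding tail_equivalent_def by blast
  obtain N where N: "\<And>n. n \<ge> N \<Longrightarrow> p n \<in> verts T"
    using infinite_connected_subgraph_of_ray[OF p(1) T(3)[unfolded p(2)] T(2,1)] by blast
  have "p n \<in> p ` {..<N}" if "p n \<notin> verts S" for n
    using N[of n] T(4) that unfolding subgraph_def by (cases "N \<le> n") auto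
  then have "verts R - verts S \<subseteq> p ` {..<N}"
    unfolding p(2) by auto
  then show ?thesis
    using finite_subset by blast
qed

lemma tail_equivalent_sym: "tail_equivalent R S \<Longrightarrow> tail_equivalent S R"
  unfolding tail_equivalent_def by blast

text \<open>Each subray contains a tail of the ambient ray; the later of the two tails is common to
  both.\<close>

lemma rays_in_ray_tail_equivalent:
  assumes "inj p" "is_ray R" "subgraph R (ray_of p)" "is_ray S" "subgraph S (ray_of p)"
  shows "tail_equivalent R S"
proof -
  have ray: "connected_graph Q \<and> infinite (verts Q)" if "is_ray Q" for Q :: "'a ugraph"
    using that connected_ray_of unfolding is_ray_iff by (auto dest: range_inj_infinite)
  obtain M where M: "\<And>n. n \<ge> M \<Longrightarrow> p n \<in> verts R" "\<And>n. n \<ge> M \<Longrightarrow> {p n, p (Suc n)} \<in> edges R"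
    using infinite_connected_subgraph_of_ray[OF assms(1,3)] ray[OF assms(2)] by blast
  obtain N where N: "\<And>n. n \<ge> N \<Longrightarrow> p n \<in> verts S" "\<And>n. n \<ge> N \<Longrightarrow> {p n, p (Suc n)} \<in> edges S"
    using infinite_connected_subgraph_of_ray[OF assms(1,5)] ray[OF assms(4)] by blast
  define q where "q n = p (n + max M N)" for n
  have q: "inj q"
    unfolding q_def by (intro injI) (auto dest: injD[OF assms(1)])
  then have "is_ray (ray_of q)"
    using is_ray_iff by blast
  moreover have "subgraph (ray_of q) R" "subgraph (ray_of q) S"
    using M N is_graph_ray_of[OF q] assms(3,5) unfolding subgraph_def by (auto simp: q_def)
  ultimately show ?thesis
    using ray unfolding tail_equivalent_def by blast
qed

section \<open>Rays in neighbourhoods and graph embeddings\<close>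

definition nbhd_ray :: "'v ugraph \<Rightarrow> 'v \<Rightarrow> 'v ugraph \<Rightarrow> bool" where
  "nbhd_ray G v R \<longleftrightarrow> is_ray R \<and> subgraph R (induced G (nbhd G v))"

lemma in_class_G_iff:
  "in_class_G G \<longleftrightarrow> is_graph G \<and>
     (\<forall>v\<in>verts G. \<forall>R S. nbhd_ray G v R \<and> nbhd_ray G v S \<longrightarrow> tail_equivalent R S)"
  unfolding in_class_G_def nbhd_ray_def by blast

lemma is_graph_induced: "is_graph G \<Longrightarrow> is_graph (induced G U)"
  unfolding is_graph_def induced_def by auto

lemma nbhd_ray_verts: "nbhd_ray G v R \<Longrightarrow> verts R \<subseteq> verts G"
  unfolding nbhd_ray_def subgraph_def induced_def by auto

lemma nbhd_rayE:
  assumes "nbhd_ray G v R"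
  obtains p where "inj p" "R = ray_of p" "\<And>n. p n \<in> nbhd G v" "\<And>n. {p n, p (Suc n)} \<in> edges G"
proof -
  obtain p where p: "inj p" "R = ray_of p"
    using assms is_ray_iff unfolding nbhd_ray_def by blast
  have "range p \<subseteq> nbhd G v" "range (\<lambda>n. {p n, p (Suc n)}) \<subseteq> edges G"
    using assms unfolding p(2) nbhd_ray_def subgraph_def induced_def by auto
  then show ?thesis
    using that p by blast
qed

text \<open>Edges are preserved but need not be reflected, because \<open>weak_emb\<close> refers to
  subgraphs that may fail to be induced.\<close>

definition graph_embedding :: "('v \<Rightarrow> 'w) \<Rightarrow> 'v ugraph \<Rightarrow> 'w ugraph \<Rightarrow> bool" where
  "graph_embedding h G H \<longleftrightarrow> inj_on h (verts G) \<and> h ` verts G \<subseteq> verts H \<and> (\<forall>e\<in>edges G. h ` e \<in> edges H)"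

lemma graph_embedding_comp:
  assumes "graph_embedding h G H" "graph_embedding k H J"
  shows "graph_embedding (k \<circ> h) G J"
proof -
  have "(k \<circ> h) ` e \<in> edges J" if "e \<in> edges G" for e
    using assms that image_comp[of k h e] unfolding graph_embedding_def by metis
  then show ?thesis
    using assms unfolding graph_embedding_def by (auto intro: comp_inj_on inj_on_subset) blast
qed

text \<open>Having embeddings in both directions lets isomorphism invariance be derived later from
  monotonicity under embeddings alone.\<close>

lemma graph_iso_embedding:
  assumes "is_graph G" "is_graph H" "graph_iso G H"
  shows "\<exists>h. graph_embedding h G H" "\<exists>h. graph_embedding h H G"
proof -
  obtain f where f: "bij_betw f (verts G) (verts H)"
    "\<And>u v. u \<in> verts G \<Longrightarrow> v \<in> verts G \<Longrightarrow> {u, v} \<in> edges G \<longleftrightarrow> {f u, f v} \<in> edges H"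
    using assms(3) unfolding graph_iso_def by blast
  have "f ` e \<in> edges H" if e: "e \<in> edges G" for e
  proof -
    obtain u v where "e = {u, v}" "u \<in> verts G" "v \<in> verts G"
      using e assms(1) unfolding is_graph_def by (metis card_2_iff insert_subset)
    then show ?thesis
      using f(2) e by auto
  qed
  then show "\<exists>h. graph_embedding h G H"
    using f(1) unfolding graph_embedding_def bij_betw_def by blast
  define g where "g = inv_into (verts G) f"
  have g: "bij_betw g (verts H) (verts G)" "\<And>u. u \<in> verts H \<Longrightarrow> f (g u) = u"
    using f(1) unfolding g_def by (auto simp: bij_betw_inv_into bij_betw_inv_into_right)
  have "g ` e \<in> edges G" if e: "e \<in> edges H" for e
  proof -
    obtain u v where uv: "e = {u, v}" "u \<in> verts H" "v \<in> verts H"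
      using e assms(2) unfolding is_graph_def by (metis card_2_iff insert_subset)
    then have "g u \<in> verts G" "g v \<in> verts G"
      using g(1) bij_betwE by blast+
    then show ?thesis
      using f(2)[of "g u" "g v"] e uv g(2) by auto
  qed
  then show "\<exists>h. graph_embedding h H G"
    using g(1) unfolding graph_embedding_def bij_betw_def by blast
qed

lemma weak_emb_embedding:
  assumes "is_graph G" "weak_emb G H"
  shows "\<exists>h. graph_embedding h G H"
proof -
  obtain K where K: "subgraph K H" "graph_iso G K"
    using assms(2) unfolding weak_emb_def by blast
  then obtain h where "graph_embedding h G K"
    using graph_iso_embedding(1) assms(1) unfolding subgraph_def by blast
  then have "graph_embedding h G H"
    using K(1) unfolding graph_embedding_def subgraph_def by fast
  then show ?thesis
    by blast
qed

text \<open>An embedding preserves adjacency to the centre and along the path, and injectivity keeps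
  the image of the path a ray. The vertex set is recorded because codes depend on nothing
  else.\<close>

lemma nbhd_ray_image:
  assumes h: "graph_embedding h G H" and H: "is_graph H" and R: "nbhd_ray G v R"
  obtains S where "nbhd_ray H (h v) S" "verts S = h ` verts R"
proof -
  obtain p where p: "inj p" "R = ray_of p"
    and verts: "\<And>n. p n \<in> nbhd G v" and edges: "\<And>n. {p n, p (Suc n)} \<in> edges G"
    using nbhd_rayE[OF R] by blast
  have "inj (h \<circ> p)"
    using h verts unfolding graph_embedding_def nbhd_def
    by (intro comp_inj_on p(1)) (auto intro: inj_on_subset)
  moreover have v: "h (p n) \<in> nbhd H (h v)" for n
    using h verts[of n] unfolding graph_embedding_def nbhd_def by fastforce
  moreover have "{h (p n), h (p (Suc n))} \<in> edges H" for n
    using h edges[of n] unfolding graph_embedding_def by fastforce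
  ultimately have "nbhd_ray H (h v) (ray_of (h \<circ> p))"
    using is_graph_induced[OF H] is_graph_ray_of[of "h \<circ> p"] is_ray_iff[of "ray_of (h \<circ> p)"]
    unfolding nbhd_ray_def subgraph_def by (auto simp: induced_def nbhd_def)
  then show ?thesis
    using that unfolding p(2) by (metis image_comp verts_ray_of)
qed

text \<open>The tree of finite sequences over A, together with one extra vertex for each w in W that is
  joined to all nodes of the branch b w. The map enc only renames the vertices.\<close>

locale branch_graph =
  fixes A :: "'b set" and W :: "'w set" and b :: "'w \<Rightarrow> nat \<Rightarrow> 'b" and enc :: "'b list + 'w \<Rightarrow> 'v"
  assumes inj_enc: "inj_on enc (Inl ` lists A \<union> Inr ` W)"
    and branch: "w \<in> W \<Longrightarrow> b w n \<in> A"
begin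

definition node :: "'b list \<Rightarrow> 'v" where
  "node t = enc (Inl t)"

definition apex :: "'w \<Rightarrow> 'v" where
  "apex w = enc (Inr w)"

definition initial :: "'w \<Rightarrow> nat \<Rightarrow> 'b list" where
  "initial w n = map (b w) [0..<n]"

definition graph :: "'v ugraph" where
  "graph = \<lparr>verts = node ` lists A \<union> apex ` W,
     edges = {{node t, node (t @ [a])} | t a. t \<in> lists A \<and> a \<in> A} \<union>
       {{apex w, node (initial w n)} | w n. w \<in> W}\<rparr>"

lemma verts_graph: "verts graph = node ` lists A \<union> apex ` W"
  and edges_graph: "edges graph = {{node t, node (t @ [a])} | t a. t \<in> lists A \<and> a \<in> A} \<union>
       {{apex w, node (initial w n)} | w n. w \<in> W}"
  by (simp_all add: graph_def)

lemma initial_lists [simp]: "w \<in> W \<Longrightarrow> initial w n \<in> lists A"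
  using branch unfolding initial_def by auto

lemma length_initial [simp]: "length (initial w n) = n"
  by (simp add: initial_def)

lemma initial_Suc: "initial w (Suc n) = initial w n @ [b w n]"
  by (simp add: initial_def)

lemma node_eq [simp]: "t \<in> lists A \<Longrightarrow> u \<in> lists A \<Longrightarrow> node t = node u \<longleftrightarrow> t = u"
  using inj_enc unfolding node_def inj_on_def by blast

lemma apex_eq [simp]: "w \<in> W \<Longrightarrow> w' \<in> W \<Longrightarrow> apex w = apex w' \<longleftrightarrow> w = w'"
  using inj_enc unfolding apex_def inj_on_def by blast

lemma node_apex [simp]: "t \<in> lists A \<Longrightarrow> w \<in> W \<Longrightarrow> node t \<noteq> apex w"
    "t \<in> lists A \<Longrightarrow> w \<in> W \<Longrightarrow> apex w \<noteq> node t"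
  using inj_enc unfolding apex_def node_def inj_on_def by blast+

lemma edge_nodes:
  assumes "t \<in> lists A" "u \<in> lists A" "{node t, node u} \<in> edges graph"
  shows "(\<exists>a. u = t @ [a]) \<or> (\<exists>a. t = u @ [a])"
  using assms(3)
proof (unfold edges_graph, elim UnE CollectE exE conjE)
  fix s a assume "{node t, node u} = {node s, node (s @ [a])}" "s \<in> lists A" "a \<in> A"
  then show ?thesis
    using assms(1,2) by (auto simp: doubleton_eq_iff)
next
  fix w n assume "{node t, node u} = {apex w, node (initial w n)}" "w \<in> W"
  then show ?thesis
    using assms(1,2) by (auto simp: doubleton_eq_iff)
qed

lemma edge_apex:
  assumes "w \<in> W" "u \<in> lists A" "{apex w, node u} \<in> edges graph"
  shows "u = initial w (length u)"
  using assms(3)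
proof (unfold edges_graph, elim UnE CollectE exE conjE)
  fix s a assume "{apex w, node u} = {node s, node (s @ [a])}" "s \<in> lists A" "a \<in> A"
  then show ?thesis
    using assms(1,2) by (auto simp: doubleton_eq_iff)
next
  fix w' n assume "{apex w, node u} = {apex w', node (initial w' n)}" "w' \<in> W"
  then show ?thesis
    using assms(1,2) by (auto simp: doubleton_eq_iff)
qed

lemma edge_apexes:
  assumes "w \<in> W" "w' \<in> W"
  shows "{apex w, apex w'} \<notin> edges graph"
  using assms by (auto simp: edges_graph doubleton_eq_iff)

lemma is_graph_graph: "is_graph graph"
  unfolding is_graph_def
proof (intro ballI)
  fix e assume "e \<in> edges graph"
  then consider t a where "e = {node t, node (t @ [a])}" "t \<in> lists A" "t @ [a] \<in> lists A"
    | w n where "e = {apex w, node (initial w n)}" "w \<in> W"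
    unfolding edges_graph by fastforce
  then show "e \<subseteq> verts graph \<and> card e = 2"
  proof cases
    case 1
    then have "node t \<noteq> node (t @ [a])"
      by simp
    with 1 show ?thesis
      unfolding verts_graph by (simp add: card_insert_if)
  next
    case 2
    then have "apex w \<noteq> node (initial w n)"
      by simp
    with 2 initial_lists[of w n] show ?thesis
      unfolding verts_graph by (simp add: card_insert_if del: initial_lists)
  qed
qed

lemma nbhd_apex:
  assumes "w \<in> W"
  shows "nbhd graph (apex w) = range (\<lambda>n. node (initial w n))"
proof
  show "nbhd graph (apex w) \<subseteq> range (\<lambda>n. node (initial w n))"
  proof
    fix v assume v: "v \<in> nbhd graph (apex w)"
    then have e: "{apex w, v} \<in> edges graph" and "v \<in> verts graph"
      unfolding nbhd_def by auto
    then consider t where "t \<in> lists A" "v = node t" | w' where "w' \<in> W" "v = apex w'"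
      unfolding verts_graph by blast
    then show "v \<in> range (\<lambda>n. node (initial w n))"
    proof cases
      case (1 t)
      then have "t = initial w (length t)"
        using e edge_apex[OF assms] by simp
      then show ?thesis
        using 1(2) by (metis rangeI)
    next
      case (2 w')
      then show ?thesis
        using e edge_apexes[OF assms] by simp
    qed
  qed
  show "range (\<lambda>n. node (initial w n)) \<subseteq> nbhd graph (apex w)"
    using initial_lists[OF assms] assms unfolding nbhd_def verts_graph edges_graph by blast
qed

lemma inj_branch: "w \<in> W \<Longrightarrow> inj (\<lambda>n. node (initial w n))"
  by (rule injI) (metis initial_lists length_initial node_eq)

text \<open>Tree edges join only sequences whose lengths differ by one, so the edges between initial
  segments of one branch are exactly those joining consecutive segments.\<close>

lemma induced_nbhd_apex:
  assumes w: "w \<in> W"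
  shows "induced graph (nbhd graph (apex w)) = ray_of (\<lambda>n. node (initial w n))"
proof -
  have "{e \<in> edges graph. e \<subseteq> range (\<lambda>n. node (initial w n))} =
      range (\<lambda>n. {node (initial w n), node (initial w (Suc n))})" (is "?L = ?R")
  proof
    show "?L \<subseteq> ?R"
    proof
      fix e assume e: "e \<in> ?L"
      then have "card e = 2"
        using is_graph_graph unfolding is_graph_def by auto
      then obtain m n where mn: "e = {node (initial w m), node (initial w n)}"
        using e unfolding card_2_iff by blast
      then have "(\<exists>a. initial w n = initial w m @ [a]) \<or> (\<exists>a. initial w m = initial w n @ [a])"
        using e edge_nodes[OF initial_lists[OF w] initial_lists[OF w]] by simp
      then have "n = Suc m \<or> m = Suc n"
        by (metis length_append_singleton length_initial)
      then show "e \<in> ?R"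
        using mn by (auto simp: insert_commute)
    qed
    show "?R \<subseteq> ?L"
    proof
      fix e assume "e \<in> ?R"
      then obtain n where n: "e = {node (initial w n), node (initial w n @ [b w n])}"
        unfolding initial_Suc by blast
      then have "e \<in> edges graph"
        using initial_lists[OF w] branch[OF w] unfolding edges_graph by blast
      then show "e \<in> ?L"
        using n unfolding initial_Suc[symmetric] by blast
    qed
  qed
  moreover have "verts graph \<inter> range (\<lambda>n. node (initial w n)) = range (\<lambda>n. node (initial w n))"
    using initial_lists[OF w] unfolding verts_graph by blast
  ultimately show ?thesis
    unfolding induced_def nbhd_apex[OF w] ray_of_def by simp
qed

lemma nbhd_ray_apex: "w \<in> W \<Longrightarrow> nbhd_ray graph (apex w) (ray_of (\<lambda>n. node (initial w n)))"
  unfolding nbhd_ray_def subgraph_def induced_nbhd_apex is_ray_iff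
  using inj_branch is_graph_ray_of by blast

text \<open>In the neighbourhood of a node t, an extra vertex is adjacent only to the parent of t and to
  one child of t. Hence a ray that has left the parent behind cannot pass through an extra vertex.\<close>

lemma no_nbhd_ray_node:
  assumes t: "t \<in> lists A"
  shows "\<not> nbhd_ray graph (node t) R"
proof
  assume R: "nbhd_ray graph (node t) R"
  obtain q where q: "inj q" and nb: "\<And>n. q n \<in> nbhd graph (node t)"
    and edge: "\<And>n. {q n, q (Suc n)} \<in> edges graph"
    using nbhd_rayE[OF R] by blast
  have cases: "(\<exists>w\<in>W. q n = apex w) \<or> (\<exists>u\<in>lists A. q n = node u)" for n
    using nb[of n] unfolding nbhd_def verts_graph by auto
  have neighbour: "(\<exists>a. u = t @ [a]) \<or> (\<exists>a. t = u @ [a])" if "u \<in> lists A" "q n = node u" for u n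
    using nb[of n] edge_nodes[OF t that(1)] that(2) unfolding nbhd_def by auto
  have len: "length u = Suc (length t) \<or> Suc (length u) = length t"
    if "u \<in> lists A" "q n = node u" for u n
    using neighbour[OF that] by auto
  \<comment> \<open>A parity argument: nodes adjacent to \<open>t\<close> have length one more or
    one less than \<open>t\<close>, whereas adjacent nodes have lengths differing by exactly
    one.\<close>
  have nodes: "\<not> ((\<exists>u\<in>lists A. q n = node u) \<and> (\<exists>u\<in>lists A. q (Suc n) = node u))" for n
  proof
    assume "(\<exists>u\<in>lists A. q n = node u) \<and> (\<exists>u\<in>lists A. q (Suc n) = node u)"
    then obtain u v where uv: "u \<in> lists A" "q n = node u" "v \<in> lists A" "q (Suc n) = node v"
      by blast
    then have "length v = Suc (length u) \<or> length u = Suc (length v)"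
      using edge_nodes[of u v] edge[of n] by auto
    then show False
      using len[OF uv(1,2)] len[OF uv(3,4)] by linarith
  qed
  \<comment> \<open>\<open>butlast t\<close> is the parent of \<open>t\<close>. For empty
    \<open>t\<close> it is \<open>t\<close> itself, and the conclusion about later vertices being
    children remains correct.\<close>
  have "finite {n. q n = node (butlast t)}"
    using finite_vimageI[OF _ q, of "{node (butlast t)}"] by (simp add: vimage_def)
  then obtain N where "\<forall>n\<in>{n. q n = node (butlast t)}. n < N"
    unfolding finite_nat_set_iff_bounded ..
  then have N: "q n \<noteq> node (butlast t)" if "n \<ge> N" for n
    using that by fastforce
  have child: "u = initial w (Suc (length t))"
    if "n \<ge> N" "u \<in> lists A" "q n = node u" "w \<in> W" "{apex w, q n} \<in> edges graph" for u n w
  proof -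
    have "\<exists>a. u = t @ [a]"
      using neighbour[OF that(2,3)] N[OF that(1)] that(3) by auto
    then show ?thesis
      using edge_apex[OF that(4,2)] that(3,5) by auto
  qed
  \<comment> \<open>Of two consecutive vertices at least one is an extra vertex. Its predecessor and
    successor on the ray are then nodes, and both are the unique child of \<open>t\<close> on its
    branch, against injectivity.\<close>
  have "\<exists>n\<ge>N. \<exists>w\<in>W. q (Suc n) = apex w"
    using nodes[of "Suc N"] cases[of "Suc N"] cases[of "Suc (Suc N)"] le_SucI[OF order_refl, of N]
    by blast
  then obtain n w where n: "n \<ge> N" "w \<in> W" "q (Suc n) = apex w"
    by blast
  obtain u where u: "u \<in> lists A" "q n = node u"
    using cases[of n] edge[of n] n(2,3) edge_apexes by auto
  obtain v where v: "v \<in> lists A" "q (Suc (Suc n)) = node v"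
    using cases[of "Suc (Suc n)"] edge[of "Suc n"] n(2,3) edge_apexes by auto
  have "u = initial w (Suc (length t))"
    using child[OF n(1) u n(2)] edge[of n] n(3) by (simp add: insert_commute)
  moreover have "v = initial w (Suc (length t))"
    using child[OF _ v n(2)] edge[of "Suc n"] n(1,3) by simp
  ultimately have "q n = q (Suc (Suc n))"
    using u v by simp
  then show False
    using injD[OF q] by fastforce
qed

lemma in_class_graph: "in_class_G graph"
  unfolding in_class_G_iff
proof (intro conjI ballI allI impI is_graph_graph)
  fix v R S assume v: "v \<in> verts graph" and RS: "nbhd_ray graph v R \<and> nbhd_ray graph v S"
  then obtain w where "w \<in> W" "v = apex w"
    using no_nbhd_ray_node unfolding verts_graph by blast
  then show "tail_equivalent R S"
    using RS rays_in_ray_tail_equivalent[OF inj_branch] unfolding nbhd_ray_def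
    by (metis induced_nbhd_apex)
qed

end

section \<open>The guessing ideal and coded reals\<close>

abbreviation almost_eq :: "nat set \<Rightarrow> nat set \<Rightarrow> bool" where
  "almost_eq A B \<equiv> eventually (\<lambda>k. k \<in> A \<longleftrightarrow> k \<in> B) sequentially"

lemma almost_eq_trans: "almost_eq A B \<Longrightarrow> almost_eq B C \<Longrightarrow> almost_eq A C"
  by (auto elim: eventually_elim2)

lemma almost_eq_sym: "almost_eq A B \<Longrightarrow> almost_eq B A"
  by (auto elim: eventually_mono)

lemma almost_eq_finite_diff: "finite (A - B) \<Longrightarrow> finite (B - A) \<Longrightarrow> almost_eq A B"
  unfolding cofinite_eq_sequentially[symmetric] eventually_cofinite
  by (rule finite_subset[of _ "(A - B) \<union> (B - A)"]) auto

lemma almost_eq_infinite: "almost_eq A B \<Longrightarrow> infinite B \<Longrightarrow> infinite A"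
  unfolding cofinite_eq_sequentially[symmetric] eventually_cofinite
  by (rule notI, erule notE, rule finite_subset[of _ "A \<union> {k. \<not> (k \<in> A \<longleftrightarrow> k \<in> B)}"]) auto

text \<open>A real number is coded by its Dedekind cut along an enumeration of the rationals; distinct
  reals have cuts that differ infinitely often.\<close>

definition cut :: "real \<Rightarrow> nat set" where
  "cut x = {k. of_rat (nat_to_rat_surj k) < x}"

lemma infinite_rationals_between:
  fixes x y :: real
  assumes "x < y"
  shows "infinite {k. x < of_rat (nat_to_rat_surj k) \<and> of_rat (nat_to_rat_surj k) < y}" (is "infinite ?Q")
proof
  assume fin: "finite ?Q"
  \<comment> \<open>Inserting \<open>x\<close> keeps the set nonempty and guarantees that a rational
    above \<open>m\<close> also exceeds \<open>x\<close>.\<close>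
  define m where "m = Max (insert x ((\<lambda>k. of_rat (nat_to_rat_surj k)) ` ?Q))"
  have "m < y" and ge: "x \<le> m" "\<And>k. k \<in> ?Q \<Longrightarrow> of_rat (nat_to_rat_surj k) \<le> m"
    unfolding m_def using fin assms by (auto simp: Max_ge_iff)
  then obtain z where z: "m < of_rat z" "of_rat z < y"
    using of_rat_dense by blast
  obtain k where k: "z = nat_to_rat_surj k"
    using surj_nat_to_rat_surj by (metis surjD)
  then have "k \<in> ?Q"
    using z ge(1) by simp
  then show False
    using ge(2)[of k] z(1) k by simp
qed

lemma infinite_cut: "infinite (cut x)"
  using infinite_rationals_between[of "x - 1" x] finite_subset unfolding cut_def
  by (metis (mono_tags, lifting) Collect_mono diff_less_eq less_add_one)

lemma cut_inj:
  assumes "almost_eq (cut x) (cut y)"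
  shows "x = y"
proof -
  have less: "\<not> x < y" if "almost_eq (cut x) (cut y)" for x y
  proof
    assume "x < y"
    moreover have "finite {k. x < of_rat (nat_to_rat_surj k) \<and> of_rat (nat_to_rat_surj k) < y}"
      using that unfolding cofinite_eq_sequentially[symmetric] eventually_cofinite
      by (rule finite_subset[rotated]) (auto simp: cut_def)
    ultimately show False
      using infinite_rationals_between by blast
  qed
  show ?thesis
    using less[OF assms] less[OF almost_eq_sym[OF assms]] by simp
qed

locale guessing_sequence = regular_cardinal r for r :: "'a rel" +
  fixes S :: "'a set" and c :: "'a \<Rightarrow> nat \<Rightarrow> 'a"
  assumes ladders: "\<delta> \<in> S \<Longrightarrow> ladder (c \<delta>) \<delta>"
    and guess: "K \<in> Field r \<rightarrow> Field r \<Longrightarrow> \<exists>\<delta>\<in>S. range (c \<delta>) \<subseteq> closure_points K"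
begin

text \<open>Allowing finitely many exceptions is what serves normality: closure points of a diagonal
  bound are known to be closure points of the \<alpha>-th function only beyond \<alpha>.\<close>

definition guesses :: "'a \<Rightarrow> ('a \<Rightarrow> 'a) \<Rightarrow> bool" where
  "guesses \<delta> K \<longleftrightarrow> eventually (\<lambda>n. c \<delta> n \<in> closure_points K) sequentially"

text \<open>The club guessing ideal of the sequence; in particular the complement of
  \<open>S\<close> belongs to it.\<close>

definition guessing_ideal :: "'a set set" where
  "guessing_ideal = {A. A \<subseteq> Field r \<and> (\<exists>K\<in>Field r \<rightarrow> Field r. \<forall>\<delta>\<in>A \<inter> S. \<not> guesses \<delta> K)}"

lemma guessing_idealI:
  assumes "A \<subseteq> Field r" "K \<in> Field r \<rightarrow> Field r" "\<And>\<delta>. \<delta> \<in> A \<Longrightarrow> \<delta> \<in> S \<Longrightarrow> \<not> guesses \<delta> K"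
  shows "A \<in> guessing_ideal"
  using assms unfolding guessing_ideal_def by blast

lemma guessing_idealE:
  assumes "A \<in> guessing_ideal"
  obtains K where "A \<subseteq> Field r" "K \<in> Field r \<rightarrow> Field r"
    "\<And>\<delta>. \<delta> \<in> A \<Longrightarrow> \<delta> \<in> S \<Longrightarrow> \<not> guesses \<delta> K"
  using assms unfolding guessing_ideal_def by blast

lemma S_Field: "\<delta> \<in> S \<Longrightarrow> \<delta> \<in> Field r"
  using ladders lt_Field unfolding ladder_def by blast

lemma c_Field: "\<delta> \<in> S \<Longrightarrow> c \<delta> n \<in> Field r"
  using ladders lt_Field unfolding ladder_def by blast

lemma guesses_antimono:
  assumes "guesses \<delta> L" "\<And>\<beta>. \<beta> \<in> Field r \<Longrightarrow> K \<beta> \<preceq> L \<beta>"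
  shows "guesses \<delta> K"
proof -
  have "closure_points L \<subseteq> closure_points K"
    using assms(2) by (rule closure_points_antimono)
  then show ?thesis
    using assms(1) unfolding guesses_def by (auto elim: eventually_mono)
qed

lemma eventually_above:
  assumes "\<delta> \<in> S" "\<alpha> \<prec> \<delta>"
  shows "eventually (\<lambda>n. \<alpha> \<prec> c \<delta> n) sequentially"
proof -
  obtain m where "\<alpha> \<prec> c \<delta> m"
    using ladders[OF assms(1)] assms(2) unfolding ladder_def by blast
  then have "\<alpha> \<prec> c \<delta> n" if "n \<ge> m" for n
    using ladder_mono[OF ladders[OF assms(1)] that] ord.less_le_trans by blast
  then show ?thesis
    unfolding eventually_sequentially by blast
qed

lemma guessing_ideal_subset: "A \<in> guessing_ideal \<Longrightarrow> B \<subseteq> A \<Longrightarrow> B \<in> guessing_ideal"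
  unfolding guessing_ideal_def by blast

lemma guessing_ideal_Un:
  assumes "A \<in> guessing_ideal" "B \<in> guessing_ideal"
  shows "A \<union> B \<in> guessing_ideal"
proof -
  obtain K where K: "A \<subseteq> Field r" "K \<in> Field r \<rightarrow> Field r"
    "\<And>\<delta>. \<delta> \<in> A \<Longrightarrow> \<delta> \<in> S \<Longrightarrow> \<not> guesses \<delta> K"
    using assms(1) by (rule guessing_idealE) blast
  obtain L where L: "B \<subseteq> Field r" "L \<in> Field r \<rightarrow> Field r"
    "\<And>\<delta>. \<delta> \<in> B \<Longrightarrow> \<delta> \<in> S \<Longrightarrow> \<not> guesses \<delta> L"
    using assms(2) by (rule guessing_idealE) blast
  have "|{K, L}| <o r"
    by (rule countable_small) simp
  then obtain M where M: "M \<in> Field r \<rightarrow> Field r"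
    "\<And>i \<beta>. i \<in> {K, L} \<Longrightarrow> \<beta> \<in> Field r \<Longrightarrow> i \<beta> \<preceq> M \<beta>"
    by (rule join[of "{K, L}" "\<lambda>i. i"]) (use K(2) L(2) in auto)
  show ?thesis
  proof (rule guessing_idealI[OF _ M(1)])
    fix \<delta> assume \<delta>: "\<delta> \<in> A \<union> B" "\<delta> \<in> S"
    show "\<not> guesses \<delta> M"
    proof
      assume "guesses \<delta> M"
      then have "guesses \<delta> K" "guesses \<delta> L"
        using M(2) by (auto intro: guesses_antimono)
      then show False
        using K(3) L(3) \<delta> by blast
    qed
  qed (use K(1) L(1) in blast)
qed

text \<open>Properness is the guessing property itself: each function is guessed at some point of
  \<open>S\<close>.\<close>

lemma Field_notin_guessing_ideal: "Field r \<notin> guessing_ideal"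
proof
  assume "Field r \<in> guessing_ideal"
  then obtain K where K: "K \<in> Field r \<rightarrow> Field r" "\<And>\<delta>. \<delta> \<in> Field r \<Longrightarrow> \<delta> \<in> S \<Longrightarrow> \<not> guesses \<delta> K"
    by (rule guessing_idealE) blast
  obtain \<delta> where "\<delta> \<in> S" "range (c \<delta>) \<subseteq> closure_points K"
    using guess[OF K(1)] by blast
  moreover from this have "guesses \<delta> K"
    unfolding guesses_def by (intro always_eventually) auto
  ultimately show False
    using K(2)[OF S_Field] by blast
qed

lemma initial_in_guessing_ideal:
  assumes "\<gamma> \<in> Field r"
  shows "under r \<gamma> \<in> guessing_ideal"
proof (rule guessing_idealI[of _ "\<lambda>_. \<gamma>"])
  show "under r \<gamma> \<subseteq> Field r"
    by (rule under_Field)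
  fix \<delta> assume \<delta>: "\<delta> \<in> under r \<gamma>" "\<delta> \<in> S"
  show "\<not> guesses \<delta> (\<lambda>_. \<gamma>)"
  proof
    assume "guesses \<delta> (\<lambda>_. \<gamma>)"
    then obtain N where "\<And>n. n \<ge> N \<Longrightarrow> c \<delta> n \<in> closure_points (\<lambda>_. \<gamma>)"
      unfolding guesses_def eventually_sequentially by blast
    \<comment> \<open>The index is \<open>Suc N\<close> because the least ordinal is vacuously a
      closure point; \<open>c \<delta> N\<close> witnesses that \<open>c \<delta> (Suc N)\<close> is
      not the least one.\<close>
    then have "c \<delta> (Suc N) \<in> closure_points (\<lambda>_. \<gamma>)"
      by simp
    then have "\<gamma> \<prec> c \<delta> (Suc N)"
      using ladders[OF \<delta>(2)] unfolding ladder_def closure_points_def by blast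
    then have "\<gamma> \<prec> \<delta>"
      using ladders[OF \<delta>(2)] ord.less_trans unfolding ladder_def by blast
    moreover have "\<delta> \<preceq> \<gamma>"
      using \<delta>(1) unfolding under_def le_def by blast
    ultimately show False
      using ord.leD by blast
  qed
qed (use assms in auto)

text \<open>Two applications of regularity, first over \<beta> and then over \<alpha>, bound the
  values below \<gamma>. The closure points of \<open>L\<close> take the place of a diagonal
  intersection of clubs.\<close>

lemma diagonal_bound:
  assumes K: "\<And>\<alpha>. \<alpha> \<in> Field r \<Longrightarrow> K \<alpha> \<in> Field r \<rightarrow> Field r"
  obtains L where "L \<in> Field r \<rightarrow> Field r"
    "\<And>\<alpha> \<beta> \<gamma>. \<gamma> \<in> Field r \<Longrightarrow> \<alpha> \<preceq> \<gamma> \<Longrightarrow> \<beta> \<preceq> \<gamma> \<Longrightarrow> K \<alpha> \<beta> \<prec> L \<gamma>"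
proof -
  have "\<exists>d\<in>Field r. \<forall>\<alpha> \<beta>. \<alpha> \<preceq> \<gamma> \<longrightarrow> \<beta> \<preceq> \<gamma> \<longrightarrow> K \<alpha> \<beta> \<prec> d" if \<gamma>: "\<gamma> \<in> Field r" for \<gamma>
  proof -
    have "\<exists>d\<in>Field r. \<forall>\<beta>. \<beta> \<preceq> \<gamma> \<longrightarrow> K \<alpha> \<beta> \<prec> d" if \<alpha>: "\<alpha> \<preceq> \<gamma>" for \<alpha>
    proof -
      have "K \<alpha> ` {b. b \<preceq> \<gamma>} \<subseteq> Field r"
        using K[OF le_Field(1)[OF \<alpha> \<gamma>]] le_Field(1)[OF _ \<gamma>] by auto
      then obtain d where "d \<in> Field r" "\<And>\<beta>. \<beta> \<in> {b. b \<preceq> \<gamma>} \<Longrightarrow> K \<alpha> \<beta> \<prec> d"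
        by (rule bounded_image[OF _ initial_small[OF \<gamma>]]) blast
      then show ?thesis
        by blast
    qed
    then obtain D where D: "\<And>\<alpha>. \<alpha> \<preceq> \<gamma> \<Longrightarrow> D \<alpha> \<in> Field r" "\<And>\<alpha> \<beta>. \<alpha> \<preceq> \<gamma> \<Longrightarrow> \<beta> \<preceq> \<gamma> \<Longrightarrow> K \<alpha> \<beta> \<prec> D \<alpha>"
      by metis
    have "D ` {b. b \<preceq> \<gamma>} \<subseteq> Field r"
      using D(1) by blast
    then obtain d where "d \<in> Field r" "\<And>\<alpha>. \<alpha> \<in> {b. b \<preceq> \<gamma>} \<Longrightarrow> D \<alpha> \<prec> d"
      by (rule bounded_image[OF _ initial_small[OF \<gamma>]]) blast
    then show ?thesis
      using D(2) ord.less_trans by blast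
  qed
  then obtain L where L: "\<forall>\<gamma>\<in>Field r. L \<gamma> \<in> Field r \<and> (\<forall>\<alpha> \<beta>. \<alpha> \<preceq> \<gamma> \<longrightarrow> \<beta> \<preceq> \<gamma> \<longrightarrow> K \<alpha> \<beta> \<prec> L \<gamma>)"
    by metis
  then show ?thesis
    using that[of L] by blast
qed

lemma diagonal_union_in_guessing_ideal:
  assumes A: "\<And>\<alpha>. \<alpha> \<in> Field r \<Longrightarrow> A \<alpha> \<in> guessing_ideal"
  shows "diagonal_union r A \<in> guessing_ideal"
proof -
  have "\<exists>K. K \<in> Field r \<rightarrow> Field r \<and> (\<forall>\<delta>\<in>A \<alpha> \<inter> S. \<not> guesses \<delta> K)" if "\<alpha> \<in> Field r" for \<alpha>
    using A[OF that] unfolding guessing_ideal_def by blast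
  then obtain K where K: "\<And>\<alpha>. \<alpha> \<in> Field r \<Longrightarrow> K \<alpha> \<in> Field r \<rightarrow> Field r"
    "\<And>\<alpha> \<delta>. \<alpha> \<in> Field r \<Longrightarrow> \<delta> \<in> A \<alpha> \<Longrightarrow> \<delta> \<in> S \<Longrightarrow> \<not> guesses \<delta> (K \<alpha>)"
    by (metis IntI)
  obtain L where L: "L \<in> Field r \<rightarrow> Field r"
    "\<And>\<alpha> \<beta> \<gamma>. \<gamma> \<in> Field r \<Longrightarrow> \<alpha> \<preceq> \<gamma> \<Longrightarrow> \<beta> \<preceq> \<gamma> \<Longrightarrow> K \<alpha> \<beta> \<prec> L \<gamma>"
    using diagonal_bound[of K] K(1) by blast
  show ?thesis
  proof (rule guessing_idealI[OF _ L(1)])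
    show "diagonal_union r A \<subseteq> Field r"
      unfolding diagonal_union_def by blast
    fix \<delta> assume \<delta>: "\<delta> \<in> diagonal_union r A" "\<delta> \<in> S"
    then obtain \<alpha> where \<alpha>: "\<alpha> \<prec> \<delta>" "\<delta> \<in> A \<alpha>"
      unfolding diagonal_union_def underS_def lt_def by blast
    \<comment> \<open>For \<beta> below \<open>d\<close>, the larger \<gamma> of \<alpha> and
      \<beta> is still below \<open>d\<close>, and \<open>L \<gamma>\<close> dominates
      \<open>K \<alpha> \<beta>\<close>.\<close>
    have sub: "d \<in> closure_points (K \<alpha>)" if d: "d \<in> closure_points L" "\<alpha> \<prec> d" for d
    proof -
      have "K \<alpha> \<beta> \<prec> d" if \<beta>: "\<beta> \<prec> d" for \<beta>
      proof -
        have "\<alpha> \<prec> \<beta> \<or> \<beta> \<preceq> \<alpha>"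
          using linear lt_Field(1) d(2) \<beta> by blast
        then obtain \<gamma> where \<gamma>: "\<gamma> \<prec> d" "\<alpha> \<preceq> \<gamma>" "\<beta> \<preceq> \<gamma>"
          using d(2) \<beta> ord.less_imp_le ord.order_refl by metis
        then have "K \<alpha> \<beta> \<prec> L \<gamma>"
          using L(2) lt_Field(1) by blast
        moreover have "L \<gamma> \<prec> d"
          using \<gamma>(1) d(1) unfolding closure_points_def by blast
        ultimately show ?thesis
          by (rule ord.less_trans)
      qed
      then show ?thesis
        using d(1) unfolding closure_points_def by blast
    qed
    have "guesses \<delta> (K \<alpha>)" if "guesses \<delta> L"
      using that eventually_above[OF \<delta>(2) \<alpha>(1)] sub unfolding guesses_def
      by (auto elim: eventually_elim2)
    then show "\<not> guesses \<delta> L"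
      using K(2)[OF lt_Field(1)[OF \<alpha>(1)] \<alpha>(2) \<delta>(2)] by blast
  qed
qed

lemma normal_guessing_ideal: "normal_ideal r guessing_ideal"
proof -
  have "guessing_ideal \<subseteq> Pow (Field r)"
    unfolding guessing_ideal_def by blast
  moreover have "{} \<in> guessing_ideal"
    by (rule guessing_idealI[of _ "\<lambda>x. x"]) auto
  ultimately have "ideal_over r guessing_ideal"
    unfolding ideal_over_def
    using Field_notin_guessing_ideal guessing_ideal_subset guessing_ideal_Un
      initial_in_guessing_ideal by simp
  then show ?thesis
    unfolding normal_ideal_def using diagonal_union_in_guessing_ideal by simp
qed

section \<open>Rankings of vertices and codes of vertex sets\<close>

lemma small_fibres_inj:
  assumes "inj_on \<rho> V" "\<rho> ` V \<subseteq> Field r" "\<beta> \<in> Field r"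
  shows "|{v \<in> V. \<rho> v \<preceq> \<beta>}| <o r"
proof (rule ordLeq_ordLess_trans[OF _ initial_small[OF assms(3)]])
  show "|{v \<in> V. \<rho> v \<preceq> \<beta>}| \<le>o |{b. b \<preceq> \<beta>}|"
    by (rule card_of_ordLeqI[of \<rho>]) (use assms(1) in \<open>auto intro: inj_on_subset\<close>)
qed

lemma rank_bound:
  assumes "\<rho>' ` V \<subseteq> Field r" "\<And>\<beta>. \<beta> \<in> Field r \<Longrightarrow> |{v \<in> V. \<rho> v \<preceq> \<beta>}| <o r"
  obtains K where "K \<in> Field r \<rightarrow> Field r"
    "\<And>\<delta> v. \<delta> \<in> closure_points K \<Longrightarrow> v \<in> V \<Longrightarrow> \<rho> v \<prec> \<delta> \<Longrightarrow> \<rho>' v \<prec> \<delta>"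
proof -
  have "\<exists>d\<in>Field r. \<forall>v\<in>V. \<rho> v \<preceq> \<beta> \<longrightarrow> \<rho>' v \<prec> d" if \<beta>: "\<beta> \<in> Field r" for \<beta>
  proof -
    have "\<rho>' ` {v \<in> V. \<rho> v \<preceq> \<beta>} \<subseteq> Field r"
      using assms(1) by blast
    then obtain d where "d \<in> Field r" "\<And>v. v \<in> {v \<in> V. \<rho> v \<preceq> \<beta>} \<Longrightarrow> \<rho>' v \<prec> d"
      by (rule bounded_image[OF _ assms(2)[OF \<beta>]]) blast
    then show ?thesis
      by blast
  qed
  then obtain K where K: "\<And>\<beta>. \<beta> \<in> Field r \<Longrightarrow> K \<beta> \<in> Field r"
    "\<And>\<beta> v. \<beta> \<in> Field r \<Longrightarrow> v \<in> V \<Longrightarrow> \<rho> v \<preceq> \<beta> \<Longrightarrow> \<rho>' v \<prec> K \<beta>"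
    by metis
  have "\<rho>' v \<prec> \<delta>" if "\<delta> \<in> closure_points K" "v \<in> V" "\<rho> v \<prec> \<delta>" for \<delta> v
  proof (rule ord.less_trans)
    show "\<rho>' v \<prec> K (\<rho> v)"
      using K(2)[OF lt_Field(1)[OF that(3)] that(2)] by blast
    show "K (\<rho> v) \<prec> \<delta>"
      using that unfolding closure_points_def by blast
  qed
  then show ?thesis
    using that[of K] K(1) by blast
qed

text \<open>Two filtrations of \<open>V\<close> into small pieces have the same pieces on a club.
  Hence the way in which vertices are identified with ordinals affects codes only modulo the
  ideal.\<close>

lemma rank_comparison:
  assumes \<rho>: "\<rho> ` V \<subseteq> Field r" "\<And>\<beta>. \<beta> \<in> Field r \<Longrightarrow> |{v \<in> V. \<rho> v \<preceq> \<beta>}| <o r"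
    and \<rho>': "\<rho>' ` V \<subseteq> Field r" "\<And>\<beta>. \<beta> \<in> Field r \<Longrightarrow> |{v \<in> V. \<rho>' v \<preceq> \<beta>}| <o r"
  obtains K where "K \<in> Field r \<rightarrow> Field r"
    "\<And>\<delta> v. \<delta> \<in> closure_points K \<Longrightarrow> v \<in> V \<Longrightarrow> \<rho> v \<prec> \<delta> \<longleftrightarrow> \<rho>' v \<prec> \<delta>"
proof -
  obtain K where K: "K \<in> Field r \<rightarrow> Field r"
    "\<And>\<delta> v. \<delta> \<in> closure_points K \<Longrightarrow> v \<in> V \<Longrightarrow> \<rho> v \<prec> \<delta> \<Longrightarrow> \<rho>' v \<prec> \<delta>"
    using rank_bound[OF \<rho>'(1) \<rho>(2)] by blast
  obtain L where L: "L \<in> Field r \<rightarrow> Field r"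
    "\<And>\<delta> v. \<delta> \<in> closure_points L \<Longrightarrow> v \<in> V \<Longrightarrow> \<rho>' v \<prec> \<delta> \<Longrightarrow> \<rho> v \<prec> \<delta>"
    using rank_bound[OF \<rho>(1) \<rho>'(2)] by blast
  have "|{K, L}| <o r"
    by (rule countable_small) simp
  then obtain M where M: "M \<in> Field r \<rightarrow> Field r"
    "\<And>i \<beta>. i \<in> {K, L} \<Longrightarrow> \<beta> \<in> Field r \<Longrightarrow> i \<beta> \<preceq> M \<beta>"
    by (rule join[of "{K, L}" "\<lambda>i. i"]) (use K(1) L(1) in auto)
  have "closure_points M \<subseteq> closure_points K" "closure_points M \<subseteq> closure_points L"
    using M(2) by (auto intro!: closure_points_antimono)
  then show ?thesis
    using that[OF M(1)] K(2) L(2) by blast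
qed

definition code :: "'a \<Rightarrow> ('v \<Rightarrow> 'a) \<Rightarrow> 'v set \<Rightarrow> nat set" where
  "code \<delta> \<rho> U = {k. \<exists>u\<in>U. c \<delta> k \<preceq> \<rho> u \<and> \<rho> u \<prec> c \<delta> (Suc k)}"

lemma code_image: "code \<delta> \<rho> (h ` U) = code \<delta> (\<rho> \<circ> h) U"
  unfolding code_def by auto

lemma interval_unique:
  assumes "\<delta> \<in> S" "c \<delta> k \<preceq> a" "a \<prec> c \<delta> (Suc k)" "c \<delta> l \<preceq> a" "a \<prec> c \<delta> (Suc l)"
  shows "k = l"
proof (rule ccontr)
  have *: False if "m < n" "c \<delta> n \<preceq> a" "a \<prec> c \<delta> (Suc m)" for m n
    using ladder_mono[OF ladders[OF assms(1)] Suc_leI[OF that(1)]] that(2,3)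
    by (meson ord.leD ord.order_trans)
  assume "k \<noteq> l"
  then show False
    using *[of k l] *[of l k] assms by fastforce
qed

text \<open>The intervals of a ladder are disjoint, so each vertex contributes at most one element
  to the code.\<close>

lemma code_finite_diff:
  assumes \<delta>: "\<delta> \<in> S" and "finite (U - U')"
  shows "finite (code \<delta> \<rho> U - code \<delta> \<rho> U')"
proof (rule finite_subset)
  define J where "J u = {k. c \<delta> k \<preceq> \<rho> u \<and> \<rho> u \<prec> c \<delta> (Suc k)}" for u
  show "code \<delta> \<rho> U - code \<delta> \<rho> U' \<subseteq> (\<Union>u\<in>U - U'. J u)"
    unfolding code_def J_def by blast
  have "J u \<subseteq> {k}" if "k \<in> J u" for u k
    using that interval_unique[OF \<delta>] unfolding J_def by blast
  then have "finite (J u)" for u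
    by (metis finite.emptyI finite_insert finite_subset all_not_in_conv)
  then show "finite (\<Union>u\<in>U - U'. J u)"
    using assms(2) by blast
qed

lemma code_tail_equivalent:
  assumes "\<delta> \<in> S" "is_ray R" "is_ray Q" "tail_equivalent R Q"
  shows "almost_eq (code \<delta> \<rho> (verts R)) (code \<delta> \<rho> (verts Q))"
  using code_finite_diff[OF assms(1)] tail_equivalent_finite_diff[OF assms(2,4)]
    tail_equivalent_finite_diff[OF assms(3) tail_equivalent_sym[OF assms(4)]]
  by (intro almost_eq_finite_diff)

text \<open>When both ends of an interval are closure points of \<open>K\<close>, the two rankings
  place the same vertices in it. Guessing provides this for almost all intervals.\<close>

lemma code_comparison:
  assumes \<delta>: "\<delta> \<in> S" "guesses \<delta> K" and "U \<subseteq> V" and F: "\<rho> ` V \<subseteq> Field r" "\<rho>' ` V \<subseteq> Field r"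
    and K: "\<And>\<delta> v. \<delta> \<in> closure_points K \<Longrightarrow> v \<in> V \<Longrightarrow> \<rho> v \<prec> \<delta> \<longleftrightarrow> \<rho>' v \<prec> \<delta>"
  shows "almost_eq (code \<delta> \<rho> U) (code \<delta> \<rho>' U)"
proof -
  have ge: "a \<preceq> b \<longleftrightarrow> \<not> b \<prec> a" if "a \<in> Field r" "b \<in> Field r" for a b
    using linear[OF that(2,1)] ord.leD by blast
  have "eventually (\<lambda>n. c \<delta> (Suc n) \<in> closure_points K) sequentially"
    using \<delta>(2) eventually_sequentially_Suc[of "\<lambda>n. c \<delta> n \<in> closure_points K"]
    unfolding guesses_def by blast
  then have "eventually (\<lambda>n. c \<delta> n \<in> closure_points K \<and> c \<delta> (Suc n) \<in> closure_points K) sequentially"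
    using \<delta>(2) unfolding guesses_def by (rule eventually_conj[rotated])
  then show ?thesis
  proof (rule eventually_mono)
    fix n assume n: "c \<delta> n \<in> closure_points K \<and> c \<delta> (Suc n) \<in> closure_points K"
    have "(c \<delta> n \<preceq> \<rho> u \<and> \<rho> u \<prec> c \<delta> (Suc n)) \<longleftrightarrow> (c \<delta> n \<preceq> \<rho>' u \<and> \<rho>' u \<prec> c \<delta> (Suc n))" if "u \<in> U" for u
    proof -
      have u: "u \<in> V" "\<rho> u \<in> Field r" "\<rho>' u \<in> Field r"
        using that assms(3) F by auto
      show ?thesis
        using ge[OF c_Field[OF \<delta>(1)] u(2)] ge[OF c_Field[OF \<delta>(1)] u(3)] K[OF _ u(1)] n by simp
    qed
    then show "n \<in> code \<delta> \<rho> U \<longleftrightarrow> n \<in> code \<delta> \<rho>' U"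
      unfolding code_def by blast
  qed
qed

definition coded_reals :: "'v ugraph \<Rightarrow> ('v \<Rightarrow> 'a) \<Rightarrow> 'a \<Rightarrow> real set" where
  "coded_reals G \<rho> \<delta> = {x. \<delta> \<in> S \<and>
     (\<exists>v\<in>verts G. \<exists>R. nbhd_ray G v R \<and> almost_eq (code \<delta> \<rho> (verts R)) (cut x))}"

text \<open>Rays in one neighbourhood are tail-equivalent and so have almost equal codes; by
  \<open>cut_inj\<close> each vertex codes at most one real. Thus the coded reals are covered by an
  image of the vertex set.\<close>

lemma coded_reals_card:
  assumes G: "in_class_G G" and card: "|verts G| \<le>o r"
  shows "|coded_reals G \<rho> \<delta>| \<le>o r"
proof -
  define P where "P v x \<longleftrightarrow> \<delta> \<in> S \<and> (\<exists>R. nbhd_ray G v R \<and> almost_eq (code \<delta> \<rho> (verts R)) (cut x))" for v x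
  have unique: "x = y" if v: "v \<in> verts G" and x: "P v x" and y: "P v y" for v x y
  proof -
    obtain R where \<delta>: "\<delta> \<in> S" and R: "nbhd_ray G v R" "almost_eq (code \<delta> \<rho> (verts R)) (cut x)"
      using x unfolding P_def by blast
    obtain Q where Q: "nbhd_ray G v Q" "almost_eq (code \<delta> \<rho> (verts Q)) (cut y)"
      using y unfolding P_def by blast
    have "tail_equivalent R Q"
      using G v R(1) Q(1) unfolding in_class_G_iff by blast
    then have "almost_eq (code \<delta> \<rho> (verts R)) (code \<delta> \<rho> (verts Q))"
      using code_tail_equivalent[OF \<delta>] R(1) Q(1) unfolding nbhd_ray_def by blast
    then have "almost_eq (cut x) (cut y)"
      using almost_eq_trans[OF almost_eq_sym[OF R(2)] almost_eq_trans[OF _ Q(2)]] by blast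
    then show ?thesis
      by (rule cut_inj)
  qed
  have "coded_reals G \<rho> \<delta> \<subseteq> (\<lambda>v. SOME x. P v x) ` verts G"
  proof
    fix x assume "x \<in> coded_reals G \<rho> \<delta>"
    then obtain v where v: "v \<in> verts G" "P v x"
      unfolding coded_reals_def P_def by blast
    then have "x = (SOME x. P v x)"
      using unique someI[of "P v" x] by blast
    then show "x \<in> (\<lambda>v. SOME x. P v x) ` verts G"
      using v(1) by blast
  qed
  then have "|coded_reals G \<rho> \<delta>| \<le>o |(\<lambda>v. SOME x. P v x) ` verts G|"
    by (rule card_of_mono1)
  also have "|(\<lambda>v. SOME x. P v x) ` verts G| \<le>o |verts G|"
    by (rule card_of_image)
  finally show ?thesis
    using card by (rule ordLeq_transitive)
qed

text \<open>Pull the ranking of \<open>H\<close> back along \<open>h\<close>. It agrees with \<rho>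
  on a club, so at guessed points a ray and its image have almost the same code.\<close>

lemma coded_reals_embedding:
  assumes h: "graph_embedding h G H" and H: "is_graph H"
    and \<rho>: "inj_on \<rho> (verts G)" "\<rho> ` verts G \<subseteq> Field r"
    and \<rho>': "inj_on \<rho>' (verts H)" "\<rho>' ` verts H \<subseteq> Field r"
  shows "{\<delta> \<in> Field r. \<not> coded_reals G \<rho> \<delta> \<subseteq> coded_reals H \<rho>' \<delta>} \<in> guessing_ideal"
proof -
  have hF: "(\<rho>' \<circ> h) ` verts G \<subseteq> Field r" and hi: "inj_on (\<rho>' \<circ> h) (verts G)"
    using h \<rho>' unfolding graph_embedding_def by (auto intro: comp_inj_on inj_on_subset)
  obtain K where K: "K \<in> Field r \<rightarrow> Field r"
    "\<And>\<delta> v. \<delta> \<in> closure_points K \<Longrightarrow> v \<in> verts G \<Longrightarrow> \<rho> v \<prec> \<delta> \<longleftrightarrow> (\<rho>' \<circ> h) v \<prec> \<delta>"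
    using rank_comparison[OF \<rho>(2) small_fibres_inj[OF \<rho>] hF small_fibres_inj[OF hi hF]] by blast
  show ?thesis
  proof (rule guessing_idealI[OF _ K(1)])
    fix \<delta> assume neg: "\<delta> \<in> {\<delta> \<in> Field r. \<not> coded_reals G \<rho> \<delta> \<subseteq> coded_reals H \<rho>' \<delta>}" and \<delta>: "\<delta> \<in> S"
    show "\<not> guesses \<delta> K"
    proof
      assume g: "guesses \<delta> K"
      have "x \<in> coded_reals H \<rho>' \<delta>" if x: "x \<in> coded_reals G \<rho> \<delta>" for x
      proof -
        obtain v R where v: "v \<in> verts G" and R: "nbhd_ray G v R" "almost_eq (code \<delta> \<rho> (verts R)) (cut x)"
          using x unfolding coded_reals_def by blast
        obtain Q where Q: "nbhd_ray H (h v) Q" "verts Q = h ` verts R"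
          using nbhd_ray_image[OF h H R(1)] by blast
        have "almost_eq (code \<delta> (\<rho>' \<circ> h) (verts R)) (code \<delta> \<rho> (verts R))"
          using almost_eq_sym[OF code_comparison[OF \<delta> g nbhd_ray_verts[OF R(1)] \<rho>(2) hF K(2)]] by blast
        then have "almost_eq (code \<delta> \<rho>' (verts Q)) (cut x)"
          unfolding Q(2) code_image using R(2) by (rule almost_eq_trans)
        moreover have "h v \<in> verts H"
          using h v unfolding graph_embedding_def by blast
        ultimately show ?thesis
          using Q(1) \<delta> unfolding coded_reals_def by blast
      qed
      then show False
        using neg by blast
    qed
  qed blast
qed

end

section \<open>Realising families of sets of reals\<close>

text \<open>Lists of a fixed length are bounded by induction, and there are only countably many
  lengths.\<close>

lemma card_of_lists_ordLeq:
  assumes A: "infinite A"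
  shows "|lists A| \<le>o |A|"
proof -
  have n: "|{t \<in> lists A. length t = n}| \<le>o |A|" for n
  proof (induction n)
    case 0
    have "{t \<in> lists A. length t = 0} = {[]}"
      by auto
    moreover have "A \<noteq> {}"
      using A by auto
    ultimately show ?case
      by (simp add: card_of_singl_ordLeq)
  next
    case (Suc n)
    have "|{t \<in> lists A. length t = Suc n}| \<le>o |(\<lambda>(a, t). a # t) ` (A \<times> {t \<in> lists A. length t = n})|"
      by (intro card_of_mono1) (auto simp: length_Suc_conv)
    also have "|(\<lambda>(a, t). a # t) ` (A \<times> {t \<in> lists A. length t = n})| \<le>o |A \<times> {t \<in> lists A. length t = n}|"
      by (rule card_of_image)
    also have "|A \<times> {t \<in> lists A. length t = n}| \<le>o |A|"
      using Suc by (intro card_of_Sigma_ordLeq_infinite[OF A]) (auto simp: card_of_refl ordIso_imp_ordLeq)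
    finally show ?case .
  qed
  have "lists A = (\<Union>n\<in>UNIV. {t \<in> lists A. length t = n})"
    by blast
  moreover have "|\<Union>n\<in>UNIV. {t \<in> lists A. length t = n}| \<le>o |A|"
    using n A by (intro card_of_UNION_ordLeq_infinite[OF A]) (simp_all add: infinite_iff_card_of_nat)
  ultimately show ?thesis
    by simp
qed

context guessing_sequence
begin

text \<open>The largest entry, with an arbitrary ordinal for \<open>[]\<close>. It ranks tree nodes
  independently of how \<open>enc\<close> names them.\<close>

definition list_rank :: "'a list \<Rightarrow> 'a" where
  "list_rank t = (SOME m. m \<in> Field r \<and> (t \<noteq> [] \<longrightarrow> m \<in> set t) \<and> (\<forall>a\<in>set t. a \<preceq> m))"

lemma list_rank:
  assumes "t \<in> lists (Field r)"
  shows "list_rank t \<in> Field r" "t \<noteq> [] \<Longrightarrow> list_rank t \<in> set t" "\<And>a. a \<in> set t \<Longrightarrow> a \<preceq> list_rank t"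
proof -
  have "\<exists>m. m \<in> Field r \<and> (t \<noteq> [] \<longrightarrow> m \<in> set t) \<and> (\<forall>a\<in>set t. a \<preceq> m)"
    using assms
  proof (induction t)
    case Nil
    then show ?case
      using infinite_Field by (metis empty_iff finite.emptyI list.set(1) subsetI subset_antisym)
  next
    case (Cons a t)
    then obtain m where m: "m \<in> Field r" "t \<noteq> [] \<longrightarrow> m \<in> set t" "\<forall>a\<in>set t. a \<preceq> m"
      by auto
    have a: "a \<in> Field r"
      by (rule Cons.hyps)
    show ?case
    proof (cases "t = [] \<or> m \<prec> a")
      case True
      then have "b \<preceq> a" if "b \<in> set t" for b
        using m(3) that ord.less_imp_le ord.order_trans by fastforce
      then show ?thesis
        using a by auto
    next
      case False
      then have "a \<preceq> m"
        using linear[OF m(1) a] by blast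
      then show ?thesis
        using m False by auto
    qed
  qed
  from someI_ex[OF this]
  show "list_rank t \<in> Field r" "t \<noteq> [] \<Longrightarrow> list_rank t \<in> set t" "\<And>a. a \<in> set t \<Longrightarrow> a \<preceq> list_rank t"
    unfolding list_rank_def by auto
qed

lemma small_lists:
  assumes "|X| <o r"
  shows "|lists X| <o r"
proof (cases "finite X")
  case True
  then show ?thesis
    by (intro countable_small countable_lists countable_finite)
next
  case False
  show ?thesis
    by (rule ordLeq_ordLess_trans[OF card_of_lists_ordLeq[OF False] assms])
qed

text \<open>Sequences of rank at most \<beta> have all entries in a small initial segment, and a
  small set has few finite sequences.\<close>

lemma small_fibres_list_rank:
  assumes "\<beta> \<in> Field r"
  shows "|{t \<in> lists (Field r). list_rank t \<preceq> \<beta>}| <o r"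
proof (rule ordLeq_ordLess_trans[OF _ small_lists[OF initial_small[OF assms]]])
  have "a \<preceq> \<beta>" if "t \<in> lists (Field r)" "list_rank t \<preceq> \<beta>" "a \<in> set t" for t a
    using list_rank(3)[OF that(1,3)] that(2) by (rule ord.order_trans)
  then have "{t \<in> lists (Field r). list_rank t \<preceq> \<beta>} \<subseteq> lists {b. b \<preceq> \<beta>}"
    unfolding in_lists_conv_set by blast
  then show "|{t \<in> lists (Field r). list_rank t \<preceq> \<beta>}| \<le>o |lists {b. b \<preceq> \<beta>}|"
    by (rule card_of_mono1)
qed

section \<open>Branches selected by reals and their codes\<close>

definition branch :: "'a \<times> real \<Rightarrow> nat \<Rightarrow> 'a" where
  "branch w n = c (fst w) (enumerate (cut (snd w)) n)"

text \<open>This is \<open>initial\<close> of the locale \<open>branch_graph\<close> for the present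
  branches, made available before an encoding has been chosen.\<close>

definition segment :: "'a \<times> real \<Rightarrow> nat \<Rightarrow> 'a list" where
  "segment w n = map (branch w) [0..<n]"

lemma branch_Field: "fst w \<in> S \<Longrightarrow> branch w n \<in> Field r"
  unfolding branch_def by (rule c_Field)

lemma segment_lists: "fst w \<in> S \<Longrightarrow> segment w n \<in> lists (Field r)"
  by (simp add: segment_def in_lists_conv_set branch_Field)

text \<open>Branches increase along the ladder, so the last entry of a segment is its
  largest.\<close>

lemma list_rank_segment:
  assumes w: "fst w \<in> S"
  shows "list_rank (segment w (Suc n)) = branch w n"
proof -
  have "branch w i \<preceq> branch w n" if "i \<le> n" for i
    unfolding branch_def using that infinite_cut
    by (intro ladder_mono[OF ladders[OF w]]) simp
  moreover have "list_rank (segment w (Suc n)) \<in> set (segment w (Suc n))"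
    using list_rank(2)[OF segment_lists[OF w], of "Suc n"] by (simp add: segment_def)
  ultimately have "list_rank (segment w (Suc n)) \<preceq> branch w n"
    unfolding segment_def by (auto simp: less_Suc_eq_le)
  moreover have "branch w n \<preceq> list_rank (segment w (Suc n))"
    using list_rank(3)[OF segment_lists[OF w], of _ "Suc n"] by (simp add: segment_def)
  ultimately show ?thesis
    by (rule ord.order_antisym)
qed

text \<open>This discards the empty segment, whose rank is arbitrary.\<close>

lemma code_segments_Suc:
  assumes "\<delta> \<in> S"
  shows "almost_eq (code \<delta> list_rank (range (segment w))) (code \<delta> list_rank (range (\<lambda>n. segment w (Suc n))))"
proof (intro almost_eq_finite_diff code_finite_diff assms)
  have "range (segment w) - range (\<lambda>n. segment w (Suc n)) \<subseteq> {segment w 0}"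
  proof
    fix t assume t: "t \<in> range (segment w) - range (\<lambda>n. segment w (Suc n))"
    then obtain n where n: "t = segment w n"
      by blast
    then show "t \<in> {segment w 0}"
      using t by (cases n) auto
  qed
  then show "finite (range (segment w) - range (\<lambda>n. segment w (Suc n)))"
    by (rule finite_subset) simp
  have "range (\<lambda>n. segment w (Suc n)) - range (segment w) = {}"
    by blast
  then show "finite (range (\<lambda>n. segment w (Suc n)) - range (segment w))"
    by (metis finite.emptyI)
qed

text \<open>The ranks along the branch are the rungs whose indices lie in the cut, and the
  \<open>k\<close>-th rung is the left end of the \<open>k\<close>-th interval.\<close>

lemma code_own_branch:
  assumes w: "fst w \<in> S"
  shows "almost_eq (code (fst w) list_rank (range (segment w))) (cut (snd w))"
proof -
  have "k \<in> code (fst w) list_rank (range (\<lambda>n. segment w (Suc n))) \<longleftrightarrow> k \<in> cut (snd w)" for k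
  proof -
    have "k \<in> code (fst w) list_rank (range (\<lambda>n. segment w (Suc n))) \<longleftrightarrow>
        (\<exists>n. c (fst w) k \<preceq> branch w n \<and> branch w n \<prec> c (fst w) (Suc k))"
      unfolding code_def using list_rank_segment[OF w] by auto
    also have "\<dots> \<longleftrightarrow> (\<exists>n. enumerate (cut (snd w)) n = k)"
    proof -
      have "c (fst w) k \<preceq> branch w n \<and> branch w n \<prec> c (fst w) (Suc k) \<longleftrightarrow> enumerate (cut (snd w)) n = k" for n
      proof -
        have "c (fst w) i \<prec> c (fst w) (Suc i)" for i
          using ladders[OF w] unfolding ladder_def by blast
        then show ?thesis
          unfolding branch_def using interval_unique[OF w] by blast
      qed
      then show ?thesis
        by simp
    qed
    also have "\<dots> \<longleftrightarrow> k \<in> cut (snd w)"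
      using enumerate_Ex enumerate_in_set[OF infinite_cut] infinite_cut by metis
    finally show ?thesis .
  qed
  then show ?thesis
    using code_segments_Suc[OF w, of w] by simp
qed

text \<open>If \<open>fst w\<close> is below \<delta>, the branch stays below \<open>fst w\<close>
  and meets only finitely many intervals of \<delta>. If it is above, only finitely many terms of
  the branch lie below \<delta>.\<close>

lemma code_other_branch:
  assumes w: "fst w \<in> S" and \<delta>: "\<delta> \<in> S" "\<delta> \<noteq> fst w"
  shows "finite (code \<delta> list_rank (range (segment w)))"
proof -
  let ?U = "range (\<lambda>n. segment w (Suc n))"
  have code: "k \<in> code \<delta> list_rank ?U \<longleftrightarrow> (\<exists>n. c \<delta> k \<preceq> branch w n \<and> branch w n \<prec> c \<delta> (Suc k))" for k
    unfolding code_def using list_rank_segment[OF w] by auto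
  have "finite (code \<delta> list_rank ?U)"
  proof (cases "fst w \<prec> \<delta>")
    case True
    have "k \<notin> code \<delta> list_rank ?U" if k: "fst w \<prec> c \<delta> k" for k
    proof
      assume "k \<in> code \<delta> list_rank ?U"
      then obtain n where "c \<delta> k \<preceq> branch w n"
        unfolding code by blast
      moreover have "branch w n \<prec> fst w"
        using ladders[OF w] unfolding branch_def ladder_def by blast
      ultimately show False
        using k by (meson ord.leD ord.less_trans)
    qed
    then have "eventually (\<lambda>k. k \<notin> code \<delta> list_rank ?U) sequentially"
      using eventually_above[OF \<delta>(1) True] by (auto elim: eventually_mono)
    then show ?thesis
      unfolding cofinite_eq_sequentially[symmetric] eventually_cofinite by simp
  next
    case False
    then have "\<delta> \<prec> fst w"
      using linear[OF S_Field[OF w] S_Field[OF \<delta>(1)]] \<delta>(2) ord.le_less by metis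
    then obtain m where m: "\<delta> \<prec> c (fst w) m"
      using ladders[OF w] unfolding ladder_def by blast
    have "n < m" if n: "branch w n \<prec> c \<delta> (Suc k)" for n k
    proof (rule ccontr)
      assume "\<not> n < m"
      then have "c (fst w) m \<preceq> branch w n"
        using le_enumerate[OF infinite_cut, of n "snd w"] unfolding branch_def
        by (intro ladder_mono[OF ladders[OF w]]) simp
      moreover have "c \<delta> (Suc k) \<prec> \<delta>"
        using ladders[OF \<delta>(1)] unfolding ladder_def by blast
      ultimately show False
        using n m by (meson ord.leD ord.less_trans)
    qed
    then have "code \<delta> list_rank ?U \<subseteq> code \<delta> list_rank ((\<lambda>n. segment w (Suc n)) ` {..<m})"
      unfolding code_def using list_rank_segment[OF w] by fastforce
    moreover have "finite (code \<delta> list_rank ((\<lambda>n. segment w (Suc n)) ` {..<m}))"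
      using code_finite_diff[OF \<delta>(1), of "(\<lambda>n. segment w (Suc n)) ` {..<m}" "{}" list_rank]
      by (simp add: code_def)
    ultimately show ?thesis
      by (rule finite_subset)
  qed
  then show ?thesis
    using almost_eq_infinite[OF almost_eq_sym[OF code_segments_Suc[OF \<delta>(1)]]] by blast
qed

text \<open>The branch graph gets one extra vertex for every pair of a point of \<open>S\<close> and
  a real prescribed there. At guessed points its own branches code exactly the prescribed reals,
  while branches towards other points have finite codes.\<close>

lemma coded_reals_surjective:
  assumes f: "f \<in> power_funs r"
  obtains G where "G \<in> graphs_of_card r" "verts G \<subseteq> Field r"
    "{\<delta> \<in> Field r. coded_reals G (\<lambda>v. v) \<delta> \<noteq> f \<delta>} \<in> guessing_ideal"
proof -
  define W where "W = (SIGMA \<delta>:S. f \<delta>)"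
  define V where "V = Inl ` lists (Field r) \<union> Inr ` W"
  have W_S: "fst w \<in> S" if "w \<in> W" for w
    using that unfolding W_def by auto
  have Field_r: "|Field r| \<le>o r"
    using card_of_Field_ordIso[OF card_order] by (rule ordIso_imp_ordLeq)
  have "|S| \<le>o r"
    using S_Field by (intro ordLeq_transitive[OF card_of_mono1 Field_r]) blast
  moreover have "|f \<delta>| \<le>o r" if "\<delta> \<in> S" for \<delta>
    using f S_Field[OF that] unfolding power_funs_def real_subsets_def by auto
  ultimately have "|W| \<le>o r"
    unfolding W_def by (intro card_of_Sigma_ordLeq_infinite_Field infinite_Field card_order) auto
  then have "|Inr ` W :: ('a list + 'a \<times> real) set| \<le>o r"
    by (rule ordLeq_transitive[OF card_of_image])
  moreover have "|lists (Field r)| \<le>o r"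
    using card_of_lists_ordLeq[OF infinite_Field] Field_r by (rule ordLeq_transitive)
  then have "|Inl ` lists (Field r) :: ('a list + 'a \<times> real) set| \<le>o r"
    by (rule ordLeq_transitive[OF card_of_image])
  ultimately have "|V| \<le>o r"
    unfolding V_def by (intro card_of_Un_ordLeq_infinite_Field infinite_Field card_order)
  then have "|V| \<le>o |Field r|"
    using ordIso_symmetric[OF card_of_Field_ordIso[OF card_order]] by (rule ordLeq_ordIso_trans)
  then obtain enc where enc: "inj_on enc V" "enc ` V \<subseteq> Field r"
    unfolding card_of_ordLeq[symmetric] by blast
  interpret branch_graph "Field r" W branch enc
    by unfold_locales (use enc(1) W_S branch_Field in \<open>auto simp: V_def\<close>)
  have initial: "initial = segment"
    by (intro ext) (simp add: initial_def segment_def)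
  have verts: "verts graph \<subseteq> Field r"
    using enc(2) unfolding verts_graph node_def apex_def V_def by blast
  have "|verts graph| \<le>o r"
    by (rule ordLeq_transitive[OF card_of_mono1[OF verts] Field_r])
  \<comment> \<open>Sequences of length one already supply lambda many vertices, whatever
    \<open>f\<close> prescribes.\<close>
  moreover have "|Field r| \<le>o |verts graph|"
  proof (rule card_of_ordLeqI[of "\<lambda>a. node [a]"])
    show "inj_on (\<lambda>a. node [a]) (Field r)"
      by (rule inj_onI) simp
    show "node [a] \<in> verts graph" if "a \<in> Field r" for a
      using that unfolding verts_graph by simp
  qed
  then have "r \<le>o |verts graph|"
    by (rule ordIso_ordLeq_trans[OF ordIso_symmetric[OF card_of_Field_ordIso[OF card_order]]])
  ultimately have G: "graph \<in> graphs_of_card r"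
    using in_class_graph unfolding graphs_of_card_def by (simp add: ordIso_iff_ordLeq)
  have node: "node ` lists (Field r) \<subseteq> Field r" "inj_on node (lists (Field r))"
    using verts node_eq unfolding verts_graph inj_on_def by blast+
  have rank: "list_rank ` lists (Field r) \<subseteq> Field r"
    using list_rank(1) by blast
  \<comment> \<open>The names given by \<open>enc\<close> are arbitrary, so ranking nodes by name is
    related to \<open>list_rank\<close> only on a club.\<close>
  obtain K where K: "K \<in> Field r \<rightarrow> Field r"
    "\<And>\<delta> t. \<delta> \<in> closure_points K \<Longrightarrow> t \<in> lists (Field r) \<Longrightarrow> node t \<prec> \<delta> \<longleftrightarrow> list_rank t \<prec> \<delta>"
    using rank_comparison[OF node(1) small_fibres_inj[OF node(2,1)] rank small_fibres_list_rank] by blast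
  have code: "almost_eq (code \<delta> (\<lambda>v. v) (range (\<lambda>n. node (segment w n)))) (code \<delta> list_rank (range (segment w)))"
    if "\<delta> \<in> S" "guesses \<delta> K" "w \<in> W" for \<delta> w
  proof -
    have "range (segment w) \<subseteq> lists (Field r)"
      using segment_lists[OF W_S[OF that(3)]] by blast
    then have "almost_eq (code \<delta> node (range (segment w))) (code \<delta> list_rank (range (segment w)))"
      using code_comparison[OF that(1,2) _ node(1) rank K(2)] by blast
    moreover have "code \<delta> (\<lambda>v. v) (range (\<lambda>n. node (segment w n))) = code \<delta> node (range (segment w))"
      unfolding code_def by auto
    ultimately show ?thesis
      by simp
  qed
  have "coded_reals graph (\<lambda>v. v) \<delta> = f \<delta>" if \<delta>: "\<delta> \<in> S" "guesses \<delta> K" for \<delta>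
  proof
    show "f \<delta> \<subseteq> coded_reals graph (\<lambda>v. v) \<delta>"
    proof
      fix x assume "x \<in> f \<delta>"
      then have w: "(\<delta>, x) \<in> W"
        unfolding W_def using \<delta>(1) by blast
      define Q where "Q = ray_of (\<lambda>n. node (segment (\<delta>, x) n))"
      have "nbhd_ray graph (apex (\<delta>, x)) Q"
        using nbhd_ray_apex[OF w] unfolding Q_def initial .
      moreover have "almost_eq (code \<delta> (\<lambda>v. v) (verts Q)) (cut x)"
        using almost_eq_trans[OF code[OF \<delta> w]] code_own_branch[of "(\<delta>, x)"] \<delta>(1)
        unfolding Q_def by simp
      moreover have "apex (\<delta>, x) \<in> verts graph"
        using w unfolding verts_graph by blast
      ultimately show "x \<in> coded_reals graph (\<lambda>v. v) \<delta>"
        using \<delta>(1) unfolding coded_reals_def by blast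
    qed
    show "coded_reals graph (\<lambda>v. v) \<delta> \<subseteq> f \<delta>"
    proof
      fix x assume "x \<in> coded_reals graph (\<lambda>v. v) \<delta>"
      then obtain v R where v: "v \<in> verts graph" and R: "nbhd_ray graph v R"
        and x: "almost_eq (code \<delta> (\<lambda>v. v) (verts R)) (cut x)"
        unfolding coded_reals_def by blast
      then obtain w where w: "w \<in> W" "v = apex w"
        using no_nbhd_ray_node unfolding verts_graph by blast
      define Q where "Q = ray_of (\<lambda>n. node (segment w n))"
      have Q: "nbhd_ray graph v Q"
        using nbhd_ray_apex[OF w(1)] unfolding Q_def w(2) initial .
      then have "tail_equivalent Q R"
        using in_class_graph v R unfolding in_class_G_iff by blast
      then have "almost_eq (code \<delta> (\<lambda>v. v) (verts Q)) (code \<delta> (\<lambda>v. v) (verts R))"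
        using code_tail_equivalent[OF \<delta>(1)] Q R unfolding nbhd_ray_def by blast
      then have Qx: "almost_eq (code \<delta> (\<lambda>v. v) (verts Q)) (cut x)"
        using x by (rule almost_eq_trans)
      have wx: "almost_eq (code \<delta> list_rank (range (segment w))) (cut x)"
        using almost_eq_trans[OF almost_eq_sym[OF code[OF \<delta> w(1)]]] Qx unfolding Q_def by simp
      \<comment> \<open>A code almost equal to a cut is infinite, which rules out branches towards
        other points.\<close>
      then have "\<delta> = fst w"
        using code_other_branch[OF W_S[OF w(1)] \<delta>(1)] almost_eq_infinite[OF wx infinite_cut] by blast
      then have "almost_eq (cut x) (cut (snd w))"
        using almost_eq_trans[OF almost_eq_sym[OF wx]] code_own_branch[OF W_S[OF w(1)]] by simp
      then have "x = snd w"
        by (rule cut_inj)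
      then show "x \<in> f \<delta>"
        using w(1) \<open>\<delta> = fst w\<close> unfolding W_def by auto
    qed
  qed
  then have "{\<delta> \<in> Field r. coded_reals graph (\<lambda>v. v) \<delta> \<noteq> f \<delta>} \<in> guessing_ideal"
    by (intro guessing_idealI[OF _ K(1)]) auto
  then show ?thesis
    using that[OF G verts] by blast
qed

end

section \<open>The homomorphisms\<close>

lemma graph_iso_refl: "graph_iso G G"
  unfolding graph_iso_def by (intro exI[of _ id]) auto

lemma graphs_of_cardD:
  assumes "G \<in> graphs_of_card r"
  shows "is_graph G" "in_class_G G" "|verts G| =o r"
  using assms unfolding graphs_of_card_def in_class_G_def by auto

lemma G_types_nonempty:
  assumes "X \<in> G_types r"
  shows "X \<noteq> {}"
  using assms graph_iso_refl unfolding G_types_def quotient_def by fastforce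

lemma G_types_members:
  assumes "X \<in> G_types r" "G \<in> X" "H \<in> X"
  shows "G \<in> graphs_of_card r" "\<exists>h. graph_embedding h G H"
proof -
  obtain J where J: "J \<in> graphs_of_card r" "G \<in> graphs_of_card r" "H \<in> graphs_of_card r"
    "graph_iso J G" "graph_iso J H"
    using assms unfolding G_types_def quotient_def by blast
  then show "G \<in> graphs_of_card r"
    by blast
  obtain h k where "graph_embedding h G J" "graph_embedding k J H"
    using graph_iso_embedding graphs_of_cardD(1) J by meson
  then show "\<exists>h. graph_embedding h G H"
    using graph_embedding_comp by blast
qed

lemma G_types_class:
  assumes "G \<in> graphs_of_card r"
  obtains X where "X \<in> G_types r" "G \<in> X"
proof
  let ?R = "{(G, H). G \<in> graphs_of_card r \<and> H \<in> graphs_of_card r \<and> graph_iso G H}"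
  show "?R `` {G} \<in> G_types r"
    unfolding G_types_def by (rule quotientI[OF assms])
  show "G \<in> ?R `` {G}"
    using assms graph_iso_refl by auto
qed

context guessing_sequence
begin

text \<open>The vertices may lie outside \<open>Field r\<close>, so an injection is chosen; another
  choice changes the coded reals only on a set in the ideal, by \<open>coded_reals_embedding\<close>
  for the identity.\<close>

definition ranking :: "'a ugraph \<Rightarrow> 'a \<Rightarrow> 'a" where
  "ranking G = (SOME \<rho>. inj_on \<rho> (verts G) \<and> \<rho> ` verts G \<subseteq> Field r)"

lemma ranking:
  assumes "|verts G| =o r"
  shows "inj_on (ranking G) (verts G)" "ranking G ` verts G \<subseteq> Field r"
proof -
  have "|verts G| \<le>o |Field r|"
    using ordIso_imp_ordLeq[OF assms] ordIso_symmetric[OF card_of_Field_ordIso[OF card_order]]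
    by (rule ordLeq_ordIso_trans)
  then have "\<exists>\<rho>. inj_on \<rho> (verts G) \<and> \<rho> ` verts G \<subseteq> Field r"
    unfolding card_of_ordLeq .
  from someI_ex[OF this] show "inj_on (ranking G) (verts G)" "ranking G ` verts G \<subseteq> Field r"
    unfolding ranking_def by auto
qed

definition invariant :: "'a ugraph \<Rightarrow> 'a \<Rightarrow> real set" where
  "invariant G = restrict (coded_reals G (ranking G)) (Field r)"

lemma invariant_power_funs:
  assumes "G \<in> graphs_of_card r"
  shows "invariant G \<in> power_funs r"
  using coded_reals_card[OF graphs_of_cardD(2)[OF assms] ordIso_imp_ordLeq[OF graphs_of_cardD(3)[OF assms]]]
  unfolding invariant_def power_funs_def real_subsets_def by auto

lemma invariant_embedding:
  assumes "G \<in> graphs_of_card r" "H \<in> graphs_of_card r" "graph_embedding h G H"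
  shows "{\<delta> \<in> Field r. \<not> invariant G \<delta> \<subseteq> invariant H \<delta>} \<in> guessing_ideal"
proof -
  have "{\<delta> \<in> Field r. \<not> invariant G \<delta> \<subseteq> invariant H \<delta>} =
      {\<delta> \<in> Field r. \<not> coded_reals G (ranking G) \<delta> \<subseteq> coded_reals H (ranking H) \<delta>}"
    unfolding invariant_def by auto
  then show ?thesis
    using coded_reals_embedding[OF assms(3) graphs_of_cardD(1)[OF assms(2)]
        ranking[OF graphs_of_cardD(3)[OF assms(1)]] ranking[OF graphs_of_cardD(3)[OF assms(2)]]]
    by simp
qed

section \<open>The reduced power and the map onto it\<close>

definition power_rel :: "(('a \<Rightarrow> real set) \<times> ('a \<Rightarrow> real set)) set" where
  "power_rel = {(f, g). f \<in> power_funs r \<and> g \<in> power_funs r \<and> {\<delta> \<in> Field r. f \<delta> \<noteq> g \<delta>} \<in> guessing_ideal}"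

lemma empty_in_guessing_ideal: "{} \<in> guessing_ideal"
  using normal_guessing_ideal unfolding normal_ideal_def ideal_over_def by blast

lemma power_rel_trans:
  assumes "(f, g) \<in> power_rel" "(g, h) \<in> power_rel"
  shows "(f, h) \<in> power_rel"
proof -
  have "{\<delta> \<in> Field r. f \<delta> \<noteq> g \<delta>} \<union> {\<delta> \<in> Field r. g \<delta> \<noteq> h \<delta>} \<in> guessing_ideal"
    using assms unfolding power_rel_def by (auto intro: guessing_ideal_Un)
  moreover have "{\<delta> \<in> Field r. f \<delta> \<noteq> h \<delta>} \<subseteq> {\<delta> \<in> Field r. f \<delta> \<noteq> g \<delta>} \<union> {\<delta> \<in> Field r. g \<delta> \<noteq> h \<delta>}"
    by auto
  ultimately have "{\<delta> \<in> Field r. f \<delta> \<noteq> h \<delta>} \<in> guessing_ideal"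
    by (rule guessing_ideal_subset)
  then show ?thesis
    using assms unfolding power_rel_def by auto
qed

lemma power_rel_sym: "(f, g) \<in> power_rel \<Longrightarrow> (g, f) \<in> power_rel"
  unfolding power_rel_def by (auto simp: eq_commute)

lemma power_rel_refl: "f \<in> power_funs r \<Longrightarrow> (f, f) \<in> power_rel"
  unfolding power_rel_def using empty_in_guessing_ideal by auto

lemma equiv_power_rel: "equiv (power_funs r) power_rel"
proof (rule equivI)
  show "power_rel \<subseteq> power_funs r \<times> power_funs r"
    unfolding power_rel_def by auto
  show "refl_on (power_funs r) power_rel"
    using power_rel_refl by (auto intro: refl_onI)
  show "sym power_rel"
    using power_rel_sym by (rule symI)
  show "trans power_rel"
    using power_rel_trans by (rule transI)
qed

lemma reduced_power_eq: "reduced_power r guessing_ideal = power_funs r // power_rel"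
  unfolding reduced_power_def power_rel_def ..

text \<open>The resulting class does not depend on the representative: members of a type embed into
  each other, so their invariants agree modulo the ideal.\<close>

definition to_power :: "'a ugraph set \<Rightarrow> ('a \<Rightarrow> real set) set" where
  "to_power X = power_rel `` {invariant (SOME G. G \<in> X)}"

lemma representative:
  assumes "X \<in> G_types r"
  shows "(SOME G. G \<in> X) \<in> X"
  using G_types_nonempty[OF assms] by (simp add: some_in_eq)

text \<open>The graphs witnessing \<open>weak_le\<close> may differ from the chosen representatives,
  so three embeddings are composed.\<close>

lemma to_power_mono:
  assumes X: "X \<in> G_types r" and Y: "Y \<in> G_types r" and le: "weak_le X Y"
  shows "reduced_le r guessing_ideal (to_power X) (to_power Y)"
proof -
  define G where "G = (SOME G. G \<in> X)"
  define H where "H = (SOME G. G \<in> Y)"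
  have G: "G \<in> X" and H: "H \<in> Y"
    unfolding G_def H_def using representative X Y by blast+
  obtain G' H' where GH': "G' \<in> X" "H' \<in> Y" "weak_emb G' H'"
    using le unfolding weak_le_def by blast
  obtain h\<^sub>1 where h1: "graph_embedding h\<^sub>1 G G'"
    using G_types_members(2)[OF X G GH'(1)] by blast
  obtain h\<^sub>2 where h2: "graph_embedding h\<^sub>2 G' H'"
    using weak_emb_embedding[OF graphs_of_cardD(1)[OF G_types_members(1)[OF X GH'(1) G]] GH'(3)] by blast
  obtain h\<^sub>3 where h3: "graph_embedding h\<^sub>3 H' H"
    using G_types_members(2)[OF Y GH'(2) H] by blast
  have GH: "G \<in> graphs_of_card r" "H \<in> graphs_of_card r"
    using G_types_members(1) X Y G H by blast+
  have "{\<delta> \<in> Field r. \<not> invariant G \<delta> \<subseteq> invariant H \<delta>} \<in> guessing_ideal"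
    using invariant_embedding[OF GH graph_embedding_comp[OF graph_embedding_comp[OF h1 h2] h3]] .
  moreover have "invariant G \<in> to_power X" "invariant H \<in> to_power Y"
    using power_rel_refl[OF invariant_power_funs] GH unfolding to_power_def G_def[symmetric] H_def[symmetric]
    by auto
  ultimately show ?thesis
    unfolding reduced_le_def by blast
qed

lemma to_power_surj_hom:
  "qo_surj_hom (G_types r) weak_le (reduced_power r guessing_ideal) (reduced_le r guessing_ideal) to_power"
proof -
  have maps: "to_power X \<in> reduced_power r guessing_ideal" if X: "X \<in> G_types r" for X
    unfolding to_power_def reduced_power_eq
    by (intro quotientI invariant_power_funs) (use G_types_members(1)[OF X] representative[OF X] in blast)
  have "Y \<in> to_power ` G_types r" if Y: "Y \<in> reduced_power r guessing_ideal" for Y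
  proof -
    obtain f where f: "f \<in> power_funs r" "Y = power_rel `` {f}"
      using Y unfolding reduced_power_eq by (rule quotientE)
    obtain G where G: "G \<in> graphs_of_card r" "verts G \<subseteq> Field r"
      "{\<delta> \<in> Field r. coded_reals G (\<lambda>v. v) \<delta> \<noteq> f \<delta>} \<in> guessing_ideal"
      using coded_reals_surjective[OF f(1)] by blast
    obtain X where X: "X \<in> G_types r" "G \<in> X"
      using G_types_class[OF G(1)] by blast
    define H where "H = (SOME G. G \<in> X)"
    have HX: "H \<in> X"
      unfolding H_def by (rule representative[OF X(1)])
    have H: "H \<in> graphs_of_card r"
      using G_types_members(1)[OF X(1) HX HX] .
    \<comment> \<open>The graph \<open>G\<close> realising \<open>f\<close> need not be the chosen
      representative \<open>H\<close>; embeddings both ways carry its coded reals over to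
      \<open>H\<close> modulo the ideal.\<close>
    obtain h k where h: "graph_embedding h G H" and k: "graph_embedding k H G"
      using G_types_members(2)[OF X(1)] X(2) HX by blast
    have id: "inj_on (\<lambda>v. v) (verts G)" "(\<lambda>v. v) ` verts G \<subseteq> Field r"
      using G(2) by auto
    let ?A = "{\<delta> \<in> Field r. \<not> coded_reals G (\<lambda>v. v) \<delta> \<subseteq> coded_reals H (ranking H) \<delta>}"
    let ?B = "{\<delta> \<in> Field r. \<not> coded_reals H (ranking H) \<delta> \<subseteq> coded_reals G (\<lambda>v. v) \<delta>}"
    let ?C = "{\<delta> \<in> Field r. coded_reals G (\<lambda>v. v) \<delta> \<noteq> f \<delta>}"
    have "?A \<in> guessing_ideal"
      by (rule coded_reals_embedding[OF h graphs_of_cardD(1)[OF H] id ranking[OF graphs_of_cardD(3)[OF H]]])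
    moreover have "?B \<in> guessing_ideal"
      by (rule coded_reals_embedding[OF k graphs_of_cardD(1)[OF G(1)] ranking[OF graphs_of_cardD(3)[OF H]] id])
    ultimately have "?A \<union> ?B \<union> ?C \<in> guessing_ideal"
      using G(3) by (intro guessing_ideal_Un)
    moreover have "{\<delta> \<in> Field r. invariant H \<delta> \<noteq> f \<delta>} \<subseteq> ?A \<union> ?B \<union> ?C"
      unfolding invariant_def by auto
    ultimately have "{\<delta> \<in> Field r. invariant H \<delta> \<noteq> f \<delta>} \<in> guessing_ideal"
      by (rule guessing_ideal_subset)
    then have "(invariant H, f) \<in> power_rel"
      using f(1) invariant_power_funs[OF H] unfolding power_rel_def by blast
    then have "to_power X = Y"
      unfolding to_power_def f(2) H_def[symmetric] by (rule equiv_class_eq[OF equiv_power_rel])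
    then show ?thesis
      using X(1) by blast
  qed
  then show ?thesis
    unfolding qo_surj_hom_def qo_hom_def using maps to_power_mono
    by (auto intro!: monotone_onI)
qed

section \<open>From the reduced power to sets of reals\<close>

definition to_reals :: "('a \<Rightarrow> real set) set \<Rightarrow> real set" where
  "to_reals Y = {x. \<exists>f\<in>Y. {\<delta> \<in> Field r. x \<notin> f \<delta>} \<in> guessing_ideal}"

text \<open>\<open>to_reals\<close> is a lower limit modulo the ideal. Changing \<open>f\<close> on
  a set in the ideal does not alter it, so any representative of the class may be used.\<close>

lemma to_reals_class:
  assumes f: "f \<in> power_funs r"
  shows "to_reals (power_rel `` {f}) = {x. {\<delta> \<in> Field r. x \<notin> f \<delta>} \<in> guessing_ideal}"
proof -
  have "{\<delta> \<in> Field r. x \<notin> f \<delta>} \<in> guessing_ideal"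
    if g: "(f, g) \<in> power_rel" and x: "{\<delta> \<in> Field r. x \<notin> g \<delta>} \<in> guessing_ideal" for g x
  proof (rule guessing_ideal_subset)
    show "{\<delta> \<in> Field r. x \<notin> g \<delta>} \<union> {\<delta> \<in> Field r. f \<delta> \<noteq> g \<delta>} \<in> guessing_ideal"
      using x g unfolding power_rel_def by (auto intro: guessing_ideal_Un)
  qed auto
  then show ?thesis
    using power_rel_refl[OF f] unfolding to_reals_def by blast
qed

lemma to_reals_hom:
  "qo_hom (reduced_power r guessing_ideal) (reduced_le r guessing_ideal) (real_subsets r) (\<subseteq>) to_reals"
  unfolding qo_hom_def
proof (intro conjI Pi_I monotone_onI)
  fix Y assume Y: "Y \<in> reduced_power r guessing_ideal"
  obtain f where f: "f \<in> power_funs r" "Y = power_rel `` {f}"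
    using Y unfolding reduced_power_eq by (rule quotientE)
  \<comment> \<open>Since the ideal is proper, such an \<open>x\<close> belongs to at least one
    \<open>f \<delta>\<close>. This places the limit inside a union of lambda many sets of size at
    most lambda.\<close>
  have "x \<in> (\<Union>\<delta>\<in>Field r. f \<delta>)" if x: "{\<delta> \<in> Field r. x \<notin> f \<delta>} \<in> guessing_ideal" for x
  proof (rule ccontr)
    assume "x \<notin> (\<Union>\<delta>\<in>Field r. f \<delta>)"
    then have "{\<delta> \<in> Field r. x \<notin> f \<delta>} = Field r"
      by auto
    then show False
      using x Field_notin_guessing_ideal by simp
  qed
  then have "to_reals Y \<subseteq> (\<Union>\<delta>\<in>Field r. f \<delta>)"
    unfolding f(2) to_reals_class[OF f(1)] by blast
  moreover have "|\<Union>\<delta>\<in>Field r. f \<delta>| \<le>o r"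
  proof (rule card_of_UNION_ordLeq_infinite_Field[OF infinite_Field card_order])
    show "|Field r| \<le>o r"
      using card_of_Field_ordIso[OF card_order] by (rule ordIso_imp_ordLeq)
    show "\<forall>\<delta>\<in>Field r. |f \<delta>| \<le>o r"
      using f(1) unfolding power_funs_def real_subsets_def by auto
  qed
  ultimately show "to_reals Y \<in> real_subsets r"
    unfolding real_subsets_def using ordLeq_transitive[OF card_of_mono1] by blast
next
  fix X Y assume X: "X \<in> reduced_power r guessing_ideal" and Y: "Y \<in> reduced_power r guessing_ideal"
    and le: "reduced_le r guessing_ideal X Y"
  obtain f g where fg: "f \<in> X" "g \<in> Y" "{\<delta> \<in> Field r. \<not> f \<delta> \<subseteq> g \<delta>} \<in> guessing_ideal"
    using le unfolding reduced_le_def by blast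
  have class_eq: "h \<in> power_funs r \<and> Z = power_rel `` {h}" if Z: "Z \<in> reduced_power r guessing_ideal" and h: "h \<in> Z" for Z h
  proof -
    obtain k where k: "k \<in> power_funs r" "Z = power_rel `` {k}"
      using Z unfolding reduced_power_eq by (rule quotientE)
    then have kh: "(k, h) \<in> power_rel"
      using h by blast
    then have "Z = power_rel `` {h}"
      unfolding k(2) by (rule equiv_class_eq[OF equiv_power_rel])
    then show ?thesis
      using kh unfolding power_rel_def by blast
  qed
  show "to_reals X \<subseteq> to_reals Y"
  proof
    fix x assume "x \<in> to_reals X"
    then have "{\<delta> \<in> Field r. x \<notin> f \<delta>} \<in> guessing_ideal"
      using class_eq[OF X fg(1)] to_reals_class[of f] by auto
    then have "{\<delta> \<in> Field r. x \<notin> f \<delta>} \<union> {\<delta> \<in> Field r. \<not> f \<delta> \<subseteq> g \<delta>} \<in> guessing_ideal"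
      using fg(3) by (rule guessing_ideal_Un)
    then have "{\<delta> \<in> Field r. x \<notin> g \<delta>} \<in> guessing_ideal"
      by (rule guessing_ideal_subset) auto
    then show "x \<in> to_reals Y"
      using fg(2) unfolding to_reals_def by blast
  qed
qed

text \<open>The class of the constant function with value \<open>A\<close> is mapped to
  \<open>A\<close>, again because the ideal is proper.\<close>

lemma to_reals_surj:
  assumes A: "A \<in> real_subsets r"
  shows "A \<in> to_reals ` reduced_power r guessing_ideal"
proof -
  define f where "f = restrict (\<lambda>_. A) (Field r)"
  have f: "f \<in> power_funs r"
    using A unfolding f_def power_funs_def by auto
  have "x \<in> A \<longleftrightarrow> {\<delta> \<in> Field r. x \<notin> f \<delta>} \<in> guessing_ideal" for x
  proof -
    have "{\<delta> \<in> Field r. x \<notin> f \<delta>} = (if x \<in> A then {} else Field r)"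
      unfolding f_def by auto
    then show ?thesis
      using empty_in_guessing_ideal Field_notin_guessing_ideal by auto
  qed
  then have "A = to_reals (power_rel `` {f})"
    unfolding to_reals_class[OF f] by blast
  then show ?thesis
    using quotientI[OF f] unfolding reduced_power_eq by blast
qed

lemma to_reals_to_power_surj_hom:
  "qo_surj_hom (G_types r) weak_le (real_subsets r) (\<subseteq>) (to_reals \<circ> to_power)"
proof -
  have P: "to_power ` G_types r = reduced_power r guessing_ideal"
    using to_power_surj_hom unfolding qo_surj_hom_def by auto
  have Q: "to_reals \<in> reduced_power r guessing_ideal \<rightarrow> real_subsets r"
    "monotone_on (reduced_power r guessing_ideal) (reduced_le r guessing_ideal) (\<subseteq>) to_reals"
    using to_reals_hom unfolding qo_hom_def by auto
  have "(to_reals \<circ> to_power) ` G_types r = real_subsets r"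
    using Q(1) to_reals_surj unfolding image_comp[symmetric] P by blast
  moreover have "monotone_on (G_types r) weak_le (\<subseteq>) (to_reals \<circ> to_power)"
  proof (rule monotone_onI)
    fix X Y assume XY: "X \<in> G_types r" "Y \<in> G_types r" "weak_le X Y"
    then have "reduced_le r guessing_ideal (to_power X) (to_power Y)"
      by (rule to_power_mono)
    moreover have "to_power X \<in> reduced_power r guessing_ideal" "to_power Y \<in> reduced_power r guessing_ideal"
      using XY P by blast+
    ultimately show "(to_reals \<circ> to_power) X \<subseteq> (to_reals \<circ> to_power) Y"
      using monotone_onD[OF Q(2)] by simp
  qed
  ultimately show ?thesis
    unfolding qo_surj_hom_def qo_hom_def by blast
qed

end

theorem theorem1p10:
  fixes r :: "'a rel"
  assumes "Card_order r" and "regularCard r" and "cardSuc natLeq <o r"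
  shows "(\<exists>\<Phi>. qo_surj_hom (G_types r) weak_le (real_subsets r) (\<subseteq>) \<Phi>) \<and>
    (\<exists>\<Phi> I \<phi> \<psi>. qo_surj_hom (G_types r) weak_le (real_subsets r) (\<subseteq>) \<Phi> \<and>
       normal_ideal r I \<and>
       qo_surj_hom (G_types r) weak_le (reduced_power r I) (reduced_le r I) \<phi> \<and>
       qo_hom (reduced_power r I) (reduced_le r I) (real_subsets r) (\<subseteq>) \<psi> \<and>
       (\<forall>X \<in> G_types r. \<Phi> X = (\<psi> \<circ> \<phi>) X))"
proof -
  interpret regular_cardinal r
    using assms by unfold_locales
  obtain S c where "\<forall>\<delta>\<in>S. ladder (c \<delta>) \<delta>"
    "\<forall>K\<in>Field r \<rightarrow> Field r. \<exists>\<delta>\<in>S. range (c \<delta>) \<subseteq> closure_points K"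
    using club_guessing by (elim exE conjE)
  then interpret guessing_sequence r S c
    by unfold_locales simp_all
  \<comment> \<open>Both parts are witnessed by the same map
    \<open>to_reals \<circ> to_power\<close>.\<close>
  show ?thesis
    using to_reals_to_power_surj_hom normal_guessing_ideal to_power_surj_hom to_reals_hom by blast
qed

end
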